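(* Let $\varepsilon>0$ be arbitrarily small and let $G\in\mathcal G(n,r,2)$ with $r^2=(1+\varepsilon)\log n/\pi$. Then a.a.s., for any two vertices $x,y$ of $G$, $\mathcal R(x\longleftrightarrow y)=O(1/\log n)$.
   Context: Random geometric graph: $\mathcal G(n,r,2)$ has as vertex set a Poisson point process of intensity $1$ on $\Lambda_n=[-\sqrt n/2,\sqrt n/2]^2$, two vertices adjacent iff at Euclidean distance $\le r$; a.a.s. means with probability tending to $1$ as $n\to\infty$. Effective resistance: for a finite connected graph with unit edge resistances, $\mathcal R(x\longleftrightarrow y)$ is the infimum, over unit flows $\theta$ from $x$ to $y$ (antisymmetric functions on oriented edges with net outflow $1$ at $x$, net inflow $1$ at $y$, conserved elsewhere), of the energy $\sum_e\theta(e)^2$. *)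

theory Defs
  imports "HOL-Probability.Probability"
begin

definition box_n :: "nat \<Rightarrow> (real^2) set" where
  "box_n n = cbox (\<chi> i. - sqrt (real n) / 2) (\<chi> i. sqrt (real n) / 2)"

text \<open>Configuration of N points p 0, ..., p (N-1); vertices are the indices i < N.
  Two distinct vertices are adjacent iff the Euclidean distance of their points is at most r.\<close>
definition rgg_adj :: "real \<Rightarrow> (nat \<Rightarrow> real^2) \<Rightarrow> nat \<Rightarrow> nat \<Rightarrow> bool" where
  "rgg_adj r p i j \<longleftrightarrow> i \<noteq> j \<and> dist (p i) (p j) \<le> r"

definition unit_flow :: "nat \<Rightarrow> (nat \<Rightarrow> nat \<Rightarrow> bool) \<Rightarrow> nat \<Rightarrow> nat \<Rightarrow> (nat \<Rightarrow> nat \<Rightarrow> real) \<Rightarrow> bool" where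
  "unit_flow N adj x y \<theta> \<longleftrightarrow>
     (\<forall>i j. \<theta> i j = - \<theta> j i) \<and>
     (\<forall>i j. \<not> (i < N \<and> j < N \<and> adj i j) \<longrightarrow> \<theta> i j = 0) \<and>
     (\<forall>v<N. (\<Sum>w<N. \<theta> v w) = (if v = x then 1 else 0) - (if v = y then 1 else 0))"

text \<open>Energy: sum of \<theta>(e)^2 over edges e, each edge counted once (hence half of the
  sum over ordered pairs).\<close>
definition flow_energy :: "nat \<Rightarrow> (nat \<Rightarrow> nat \<Rightarrow> real) \<Rightarrow> real" where
  "flow_energy N \<theta> = (\<Sum>i<N. \<Sum>j<N. (\<theta> i j)^2) / 2"

text \<open>Effective resistance as infimum of energies over unit flows, in ennreal
  (infinite if there is no unit flow, i.e. x and y lie in different components).\<close>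
definition eff_res :: "nat \<Rightarrow> (nat \<Rightarrow> nat \<Rightarrow> bool) \<Rightarrow> nat \<Rightarrow> nat \<Rightarrow> ennreal" where
  "eff_res N adj x y = (INF \<theta>\<in>{\<theta>. unit_flow N adj x y \<theta>}. ennreal (flow_energy N \<theta>))"

text \<open>Law of a Poisson point process of intensity 1 on \<Lambda>_n: the number of points N is
  Poisson with mean |\<Lambda>_n| = n, and given N the points are i.i.d. uniform on \<Lambda>_n.
  ppp_prob n P is the probability that the configuration (N, p) satisfies P.\<close>
definition ppp_prob :: "nat \<Rightarrow> (nat \<Rightarrow> (nat \<Rightarrow> real^2) \<Rightarrow> bool) \<Rightarrow> real" where
  "ppp_prob n P = (\<Sum>N. (real n ^ N / fact N * exp (- real n)) *
      measure (PiM {..<N} (\<lambda>_. uniform_measure lborel (box_n n)))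
              {p \<in> space (PiM {..<N} (\<lambda>_. uniform_measure lborel (box_n n))). P N p})"

end

theory Submission
  imports Defs "HOL-Real_Asymp.Real_Asymp"
begin

text \<open>Divide the box into square cells whose side is a small constant multiple of \<open>r\<close> and call a
  cell good if it contains at least \<open>\<delta> log n\<close> points. By a Chernoff bound, a fixed set of cells whose
  total area is a multiple \<open>\<theta> > 1\<close> of \<open>log n\<close> consists of bad cells with probability
  \<open>o(1 / n)\<close>; the bounds needed at the sides and at the corners of the box are \<open>o(1 / \<surd>n)\<close> and
  \<open>o(1)\<close>. Since \<open>\<pi> r\<^sup>2 > log n\<close>, a.a.s. no cluster of cells of bounded diameter is cut off from the
  other good cells: the half discs above its topmost and below its bottommost cell would be bad.
  So the good cells near any given cell are connected inside a window of bounded size, and a flow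
  on the full grid of cells can be rerouted through good cells at the cost of a constant factor.
  In the grid, spreading the current as in Polya's urn gives resistance \<open>O(log n)\<close> between any two cells,
  and replacing each cell by \<open>\<delta> log n\<close> points divides this by \<open>(\<delta> log n)\<^sup>2\<close>. Finally
  each vertex is joined to all chosen points of some good cell, at cost \<open>O(1 / log n)\<close>.\<close>

text \<open>The sharp radius enters through one inequality. In cells of side about
  \<open>r / R\<close>, two half discs of radius \<open>R\<close> consist of \<open>2h\<close> cells
  of total area about \<open>(1 + \<epsilon>) log n\<close>; a large \<open>R\<close> makes the
  lattice error smaller than \<open>\<epsilon>\<close>. A single half disc has about half of that
  area, which suffices only where \<open>O(\<surd>n)\<close> windows compete, that is, along the
  sides. At the corners there are boundedly many windows, and already one bad cell is unlikely. The
  union bound runs over all sets of \<open>2h\<close>, \<open>h\<close> or 1 cells of a window, so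
  the size of windows must not grow with \<open>n\<close>, whereas a cluster of good cells may be
  long. Good rows and columns remove this obstacle: fewer than \<open>2h\<close> bad cells leave a
  line without bad cells among any \<open>2h\<close> consecutive lines of a window. A cluster that
  avoids all such lines is small, so the half discs apply to it; any other cluster is linked to the
  crossing of a good row with a good column.\<close>

section \<open>Flows and their energy\<close>

text \<open>An arbitrary divergence \<open>d\<close> instead of a source and a sink lets the uniform
  distribution on an antidiagonal or on points of a cell act as a terminal; divergences add and
  scale with the flows.\<close>

definition flow_on :: "'a set \<Rightarrow> ('a \<Rightarrow> 'a \<Rightarrow> bool) \<Rightarrow> ('a \<Rightarrow> real) \<Rightarrow> ('a \<Rightarrow> 'a \<Rightarrow> real) \<Rightarrow> bool" where
  "flow_on V E d \<theta> \<longleftrightarrow>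
     (\<forall>u v. \<theta> u v = - \<theta> v u) \<and>
     (\<forall>u v. \<not> (u \<in> V \<and> v \<in> V \<and> E u v) \<longrightarrow> \<theta> u v = 0) \<and>
     (\<forall>u\<in>V. (\<Sum>v\<in>V. \<theta> u v) = d u)"

text \<open>Ordered pairs count every edge twice; \<open>flow_energy_eq\<close> removes the factor
  once the unit flow is complete.\<close>

definition energy_on :: "'a set \<Rightarrow> ('a \<Rightarrow> 'a \<Rightarrow> real) \<Rightarrow> real" where
  "energy_on V \<theta> = (\<Sum>u\<in>V. \<Sum>v\<in>V. (\<theta> u v)^2)"

definition point_mass :: "'a \<Rightarrow> 'a \<Rightarrow> real" where
  "point_mass a v = (if v = a then 1 else 0)"

lemma unit_flow_iff:
  "unit_flow N adj x y \<theta> \<longleftrightarrow> flow_on {..<N} adj (\<lambda>v. point_mass x v - point_mass y v) \<theta>"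
  unfolding unit_flow_def flow_on_def point_mass_def by (simp only: lessThan_iff Ball_def)

lemma flow_energy_eq: "flow_energy N \<theta> = energy_on {..<N} \<theta> / 2"
  by (simp add: flow_energy_def energy_on_def)

lemma flow_on_antisym: "flow_on V E d \<theta> \<Longrightarrow> \<theta> u v = - \<theta> v u"
  unfolding flow_on_def by blast

lemma flow_on_support: "flow_on V E d \<theta> \<Longrightarrow> \<not> (u \<in> V \<and> v \<in> V \<and> E u v) \<Longrightarrow> \<theta> u v = 0"
  unfolding flow_on_def by blast

lemma flow_on_div: "flow_on V E d \<theta> \<Longrightarrow> u \<in> V \<Longrightarrow> (\<Sum>v\<in>V. \<theta> u v) = d u"
  unfolding flow_on_def by blast

lemma flow_on_cong:
  assumes "flow_on V E d \<theta>" "\<And>v. v \<in> V \<Longrightarrow> d v = d' v"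
  shows "flow_on V E d' \<theta>"
  unfolding flow_on_def
proof (intro conjI allI impI ballI)
  show "\<theta> u v = - \<theta> v u" for u v
    by (rule flow_on_antisym[OF assms(1)])
  show "\<theta> u v = 0" if "\<not> (u \<in> V \<and> v \<in> V \<and> E u v)" for u v
    using flow_on_support[OF assms(1) that] .
  show "(\<Sum>v\<in>V. \<theta> u v) = d' u" if "u \<in> V" for u
    using flow_on_div[OF assms(1) that] assms(2)[OF that] by simp
qed

lemma flow_on_zero: "flow_on V E (\<lambda>_. 0) (\<lambda>_ _. 0)"
  by (simp add: flow_on_def)

lemma flow_on_add:
  assumes "flow_on V E d \<theta>" "flow_on V E d' \<theta>'"
  shows "flow_on V E (\<lambda>v. d v + d' v) (\<lambda>u v. \<theta> u v + \<theta>' u v)"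
  unfolding flow_on_def
proof (intro conjI allI impI ballI)
  show "\<theta> u v + \<theta>' u v = - (\<theta> v u + \<theta>' v u)" for u v
    using flow_on_antisym[OF assms(1), of u v] flow_on_antisym[OF assms(2), of u v] by simp
  show "\<theta> u v + \<theta>' u v = 0" if "\<not> (u \<in> V \<and> v \<in> V \<and> E u v)" for u v
    using flow_on_support[OF assms(1) that] flow_on_support[OF assms(2) that] by simp
  show "(\<Sum>v\<in>V. \<theta> u v + \<theta>' u v) = d u + d' u" if "u \<in> V" for u
    using flow_on_div[OF assms(1) that] flow_on_div[OF assms(2) that] by (simp add: sum.distrib)
qed

lemma flow_on_scale:
  assumes "flow_on V E d \<theta>"
  shows "flow_on V E (\<lambda>v. c * d v) (\<lambda>u v. c * \<theta> u v)"
  unfolding flow_on_def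
proof (intro conjI allI impI ballI)
  show "c * \<theta> u v = - (c * \<theta> v u)" for u v
    using flow_on_antisym[OF assms(1), of u v] by simp
  show "c * \<theta> u v = 0" if "\<not> (u \<in> V \<and> v \<in> V \<and> E u v)" for u v
    using flow_on_support[OF assms(1) that] by simp
  show "(\<Sum>v\<in>V. c * \<theta> u v) = c * d u" if "u \<in> V" for u
    using flow_on_div[OF assms(1) that] by (simp flip: sum_distrib_left)
qed

lemma flow_on_sum:
  assumes "finite I" "\<And>i. i \<in> I \<Longrightarrow> flow_on V E (d i) (\<theta> i)"
  shows "flow_on V E (\<lambda>v. \<Sum>i\<in>I. d i v) (\<lambda>u v. \<Sum>i\<in>I. \<theta> i u v)"
  using assms
proof (induction I rule: finite_induct)
  case empty
  show ?case by (simp add: flow_on_zero)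
next
  case (insert i I)
  then show ?case using flow_on_add[of V E "d i" "\<theta> i"] by simp
qed

lemma energy_on_scale: "energy_on V (\<lambda>u v. c * \<theta> u v) = c^2 * energy_on V \<theta>"
  unfolding energy_on_def by (simp add: power_mult_distrib sum_distrib_left)

lemma energy_on_add_le:
  "energy_on V (\<lambda>u v. \<theta> u v + \<theta>' u v) \<le> 2 * energy_on V \<theta> + 2 * energy_on V \<theta>'"
proof -
  have *: "(x + y)^2 \<le> 2 * x^2 + 2 * y^2" for x y :: real
    using sum_squares_bound[of x y] by (simp add: power2_sum)
  have "energy_on V (\<lambda>u v. \<theta> u v + \<theta>' u v) \<le>
      (\<Sum>u\<in>V. \<Sum>v\<in>V. 2 * (\<theta> u v)^2 + 2 * (\<theta>' u v)^2)"
    unfolding energy_on_def by (intro sum_mono *)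
  then show ?thesis
    unfolding energy_on_def by (simp add: sum.distrib sum_distrib_left)
qed

text \<open>Exact additivity matters when many flows are stacked: the factor 2 of
  \<open>energy_on_add_le\<close> would be incurred anew with every level.\<close>

lemma energy_on_add_disjoint:
  assumes "\<And>u v. \<theta> u v * \<theta>' u v = 0"
  shows "energy_on V (\<lambda>u v. \<theta> u v + \<theta>' u v) = energy_on V \<theta> + energy_on V \<theta>'"
proof -
  have "(\<theta> u v + \<theta>' u v)^2 = (\<theta> u v)^2 + (\<theta>' u v)^2" for u v
    using assms[of u v] by (simp add: power2_sum)
  then show ?thesis unfolding energy_on_def by (simp add: sum.distrib)
qed

section \<open>Current along an edge, and the urn flow between consecutive antidiagonals\<close>

definition edge_flow :: "'a \<Rightarrow> 'a \<Rightarrow> 'a \<Rightarrow> 'a \<Rightarrow> real" where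
  "edge_flow p q u v = point_mass p u * point_mass q v - point_mass q u * point_mass p v"

lemma edge_flow_nonzero:
  "edge_flow p q u v \<noteq> 0 \<Longrightarrow> u = p \<and> v = q \<or> u = q \<and> v = p"
  by (auto simp: edge_flow_def point_mass_def split: if_splits)

lemma sum_point_mass: "finite V \<Longrightarrow> a \<in> V \<Longrightarrow> (\<Sum>v\<in>V. point_mass a v) = 1"
  by (simp add: point_mass_def)

lemma flow_on_edge_flow:
  assumes "finite V" "p \<in> V" "q \<in> V" "E p q" "E q p"
  shows "flow_on V E (\<lambda>v. point_mass p v - point_mass q v) (edge_flow p q)"
  unfolding flow_on_def
proof (intro conjI allI impI ballI)
  show "(\<Sum>v\<in>V. edge_flow p q u v) = point_mass p u - point_mass q u" for u
    using assms
    by (simp add: edge_flow_def sum_subtractf sum_point_mass flip: sum_distrib_left)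
qed (use assms in \<open>auto simp: edge_flow_def point_mass_def\<close>)

text \<open>The vertex \<open>f i (d - i)\<close> carries mass \<open>1 / (d + 1)\<close> and sends
  the fractions \<open>(i + 1) / (d + 2)\<close> and \<open>(d - i + 1) / (d + 2)\<close> of it
  along its two outgoing edges.\<close>

definition polya_level :: "(nat \<Rightarrow> nat \<Rightarrow> 'a) \<Rightarrow> nat \<Rightarrow> 'a \<Rightarrow> 'a \<Rightarrow> real" where
  "polya_level f d u v = (\<Sum>i\<le>d.
     (real i + 1) / ((real d + 1) * (real d + 2)) * edge_flow (f i (d - i)) (f (Suc i) (d - i)) u v +
     (real (d - i) + 1) / ((real d + 1) * (real d + 2)) * edge_flow (f i (d - i)) (f i (Suc (d - i))) u v)"

definition antidiag :: "(nat \<Rightarrow> nat \<Rightarrow> 'a) \<Rightarrow> nat \<Rightarrow> 'a \<Rightarrow> real" where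
  "antidiag f d v = (\<Sum>i\<le>d. point_mass (f i (d - i)) v) / (real d + 1)"

text \<open>The vertex with index \<open>i\<close> on the next antidiagonal receives
  \<open>i / ((d + 1) * (d + 2))\<close> from one side and
  \<open>(d + 1 - i) / ((d + 1) * (d + 2))\<close> from the other. The sum is
  \<open>1 / (d + 2)\<close> for every \<open>i\<close>.\<close>

lemma polya_level_flow:
  assumes V: "finite V" "\<And>i j. i + j \<le> Suc d \<Longrightarrow> f i j \<in> V"
    and E: "\<And>i j. i + j \<le> d \<Longrightarrow> E (f i j) (f (Suc i) j) \<and> E (f (Suc i) j) (f i j)"
      "\<And>i j. i + j \<le> d \<Longrightarrow> E (f i j) (f i (Suc j)) \<and> E (f i (Suc j)) (f i j)"
  shows "flow_on V E (\<lambda>v. antidiag f d v - antidiag f (Suc d) v) (polya_level f d)"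
proof -
  define c where "c = 1 / ((real d + 1) * (real d + 2))"
  define P where "P = (\<lambda>i j v. point_mass (f i j) v)"
  have flow: "flow_on V E (\<lambda>v. \<Sum>i\<le>d.
      (real i + 1) / ((real d + 1) * (real d + 2)) * (P i (d - i) v - P (Suc i) (d - i) v) +
      (real (d - i) + 1) / ((real d + 1) * (real d + 2)) * (P i (d - i) v - P i (Suc (d - i)) v)) (polya_level f d)"
    unfolding polya_level_def[abs_def] P_def
    by (intro flow_on_sum flow_on_add flow_on_scale flow_on_edge_flow) (use V E in auto)
  show ?thesis
  proof (rule flow_on_cong[OF flow])
    fix v assume "v \<in> V"
    have "(\<Sum>i\<le>d. (real i + 1) / ((real d + 1) * (real d + 2)) * (P i (d - i) v - P (Suc i) (d - i) v) +
      (real (d - i) + 1) / ((real d + 1) * (real d + 2)) * (P i (d - i) v - P i (Suc (d - i)) v))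
      = (\<Sum>i\<le>d. c * ((real d + 2) * P i (d - i) v) - c * ((real i + 1) * P (Suc i) (d - i) v) -
          c * ((real d + 1 - real i) * P i (Suc d - i) v))"
    proof (intro sum.cong refl, goal_cases)
      case (1 i)
      then have i: "Suc (d - i) = Suc d - i" "real (d - i) = real d - real i" by (auto simp: of_nat_diff)
      have *: "(x + 1) / D * (p - q) + (y - x + 1) / D * (p - r) =
            1 / D * ((y + 2) * p) - 1 / D * ((x + 1) * q) - 1 / D * ((y + 1 - x) * r)" if "D \<noteq> 0" for x y D p q r :: real
        using that by (simp add: field_simps)
      show ?case unfolding c_def i by (rule *) auto
    qed
    also have "\<dots> = c * (real d + 2) * (\<Sum>i\<le>d. P i (d - i) v) -
        c * ((\<Sum>i\<le>d. (real i + 1) * P (Suc i) (d - i) v) + (\<Sum>i\<le>d. (real d + 1 - real i) * P i (Suc d - i) v))"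
      by (simp only: sum_subtractf sum_distrib_left[symmetric]) (simp only: right_diff_distrib diff_diff_eq mult.assoc distrib_left[of c "sum _ _" "sum _ _"])
    \<comment> \<open>Extending both sums of incoming current to the whole of level
      \<open>d + 1\<close> adds only terms with coefficient 0, at \<open>i = 0\<close> here and at
      \<open>i = d + 1\<close> in the next step.\<close>
    also have "(\<Sum>i\<le>d. (real i + 1) * P (Suc i) (d - i) v) = (\<Sum>i\<le>Suc d. real i * P i (Suc d - i) v)"
      by (subst sum.atMost_Suc_shift) (simp add: add.commute)
    also have "(\<Sum>i\<le>d. (real d + 1 - real i) * P i (Suc d - i) v) =
        (\<Sum>i\<le>Suc d. (real d + 1 - real i) * P i (Suc d - i) v)"
      by simp
    also have "(\<Sum>i\<le>Suc d. real i * P i (Suc d - i) v) + (\<Sum>i\<le>Suc d. (real d + 1 - real i) * P i (Suc d - i) v)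
        = (\<Sum>i\<le>Suc d. (real d + 1) * P i (Suc d - i) v)"
      unfolding sum.distrib[symmetric] by (intro sum.cong refl) (simp add: algebra_simps)
    also have "\<dots> = (real d + 1) * (\<Sum>i\<le>Suc d. P i (Suc d - i) v)"
      by (simp only: sum_distrib_left)
    also have "c * (real d + 2) * (\<Sum>i\<le>d. P i (d - i) v) - c * ((real d + 1) * (\<Sum>i\<le>Suc d. P i (Suc d - i) v))
       = antidiag f d v - antidiag f (Suc d) v"
    proof -
      have c1: "c * (real d + 2) = 1 / (real d + 1)" unfolding c_def by (simp add: divide_simps)
      have c2: "c * (real d + 1) = 1 / (real (Suc d) + 1)" unfolding c_def by (simp add: divide_simps)
      show ?thesis unfolding antidiag_def P_def mult.assoc[symmetric] c1 c2 by simp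
    qed
    finally show "(\<Sum>i\<le>d.
      (real i + 1) / ((real d + 1) * (real d + 2)) * (P i (d - i) v - P (Suc i) (d - i) v) +
      (real (d - i) + 1) / ((real d + 1) * (real d + 2)) * (P i (d - i) v - P i (Suc (d - i)) v)) =
      antidiag f d v - antidiag f (Suc d) v" .
  qed
qed

lemma abs_edge_flow_le: "\<bar>edge_flow p q u v\<bar> \<le> point_mass p u + point_mass p v"
  by (auto simp: edge_flow_def point_mass_def)

lemma sum_abs_edge_flow_le:
  assumes "finite V"
  shows "(\<Sum>u\<in>V. \<Sum>v\<in>V. \<bar>edge_flow p q u v\<bar>) \<le> 2"
proof -
  have 1: "(\<Sum>v\<in>V. point_mass a v) \<le> 1" "0 \<le> (\<Sum>v\<in>V. point_mass a v)" for a
    using assms by (auto simp: point_mass_def)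
  have "(\<Sum>u\<in>V. \<Sum>v\<in>V. \<bar>edge_flow p q u v\<bar>) \<le>
     (\<Sum>u\<in>V. \<Sum>v\<in>V. point_mass p u * point_mass q v + point_mass q u * point_mass p v)"
    by (intro sum_mono) (auto simp: edge_flow_def point_mass_def)
  also have "\<dots> = 2 * ((\<Sum>u\<in>V. point_mass p u) * (\<Sum>v\<in>V. point_mass q v))"
    by (simp only: sum.distrib sum_product[symmetric]) simp
  also have "\<dots> \<le> 2 * (1 * 1)"
    by (intro mult_left_mono mult_mono 1) auto
  finally show ?thesis by simp
qed

lemma polya_level_abs_le:
  "\<bar>polya_level f d u v\<bar> \<le> (\<Sum>i\<le>d. (real i + 1) / ((real d + 1) * (real d + 2)) * \<bar>edge_flow (f i (d - i)) (f (Suc i) (d - i)) u v\<bar> +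
     (real (d - i) + 1) / ((real d + 1) * (real d + 2)) * \<bar>edge_flow (f i (d - i)) (f i (Suc (d - i))) u v\<bar>)"
proof -
  have *: "\<bar>x * p + y * q\<bar> \<le> x * \<bar>p\<bar> + y * \<bar>q\<bar>" if "x \<ge> 0" "y \<ge> 0" for x y p q :: real
    using that abs_triangle_ineq[of "x * p" "y * q"] by (simp add: abs_mult)
  show ?thesis
    unfolding polya_level_def by (rule order_trans[OF sum_abs], rule sum_mono, rule *) simp_all
qed

lemma polya_weights:
  assumes "i \<le> d"
  shows "(real i + 1) / ((real d + 1) * (real d + 2)) + (real (d - i) + 1) / ((real d + 1) * (real d + 2)) = 1 / (real d + 1)"
proof -
  have "(real i + 1) + (real (d - i) + 1) = real d + 2"
    using assms by (simp add: of_nat_diff)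
  then show ?thesis
    unfolding add_divide_distrib[symmetric] by (simp add: divide_simps)
qed

text \<open>A sum of squares is at most the largest absolute value times the sum of absolute values.
  The former is at most \<open>2 / (d + 1)\<close>, since by injectivity each endpoint of an edge is
  at most one vertex of the level; the latter is at most 2, the total current 1 counted in both
  orientations.\<close>

lemma polya_level_energy:
  assumes "finite V" and inj: "\<And>i j i' j'. f i j = f i' j' \<Longrightarrow> i = i' \<and> j = j'"
  shows "energy_on V (polya_level f d) \<le> 4 / (real d + 1)"
proof -
  let ?a = "\<lambda>i. (real i + 1) / ((real d + 1) * (real d + 2))"
  let ?b = "\<lambda>i. (real (d - i) + 1) / ((real d + 1) * (real d + 2))"
  let ?e = "\<lambda>i u v. \<bar>edge_flow (f i (d - i)) (f (Suc i) (d - i)) u v\<bar>"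
  let ?g = "\<lambda>i u v. \<bar>edge_flow (f i (d - i)) (f i (Suc (d - i))) u v\<bar>"
  have pm: "(\<Sum>i\<le>d. point_mass (f i (d - i)) w) \<le> 1" for w
  proof (cases "\<exists>i\<le>d. w = f i (d - i)")
    case True
    then obtain i where i: "i \<le> d" "w = f i (d - i)" by blast
    have "(\<Sum>j\<le>d. point_mass (f j (d - j)) w) = (\<Sum>j\<le>d. if j = i then 1 else 0)"
      by (intro sum.cong) (use i inj in \<open>auto simp: point_mass_def\<close>)
    then show ?thesis using i by simp
  next
    case False
    then have "(\<Sum>i\<le>d. point_mass (f i (d - i)) w) = 0"
      by (intro sum.neutral) (auto simp: point_mass_def)
    then show ?thesis by simp
  qed
  have max: "\<bar>polya_level f d u v\<bar> \<le> 2 / (real d + 1)" for u v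
  proof -
    have "\<bar>polya_level f d u v\<bar> \<le> (\<Sum>i\<le>d. ?a i * ?e i u v + ?b i * ?g i u v)"
      by (rule polya_level_abs_le)
    also have "\<dots> \<le> (\<Sum>i\<le>d. ?a i * (point_mass (f i (d - i)) u + point_mass (f i (d - i)) v) +
          ?b i * (point_mass (f i (d - i)) u + point_mass (f i (d - i)) v))"
      by (intro sum_mono add_mono mult_left_mono abs_edge_flow_le) auto
    also have "\<dots> = (\<Sum>i\<le>d. 1 / (real d + 1) * (point_mass (f i (d - i)) u + point_mass (f i (d - i)) v))"
      unfolding distrib_right[symmetric] by (intro sum.cong refl) (use polya_weights in auto)
    also have "\<dots> = 1 / (real d + 1) * ((\<Sum>i\<le>d. point_mass (f i (d - i)) u) + (\<Sum>i\<le>d. point_mass (f i (d - i)) v))"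
      by (simp only: sum_distrib_left sum.distrib distrib_left)
    also have "\<dots> \<le> 1 / (real d + 1) * (1 + 1)"
      by (intro mult_left_mono add_mono pm) auto
    finally show ?thesis by simp
  qed
  have "(\<Sum>u\<in>V. \<Sum>v\<in>V. \<bar>polya_level f d u v\<bar>) \<le> (\<Sum>u\<in>V. \<Sum>v\<in>V. \<Sum>i\<le>d. ?a i * ?e i u v + ?b i * ?g i u v)"
    by (intro sum_mono polya_level_abs_le)
  also have "\<dots> = (\<Sum>u\<in>V. \<Sum>i\<le>d. \<Sum>v\<in>V. ?a i * ?e i u v + ?b i * ?g i u v)"
    by (rule sum.cong[OF refl], rule sum.swap)
  also have "\<dots> = (\<Sum>i\<le>d. \<Sum>u\<in>V. \<Sum>v\<in>V. ?a i * ?e i u v + ?b i * ?g i u v)"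
    by (rule sum.swap)
  also have "\<dots> = (\<Sum>i\<le>d. ?a i * (\<Sum>u\<in>V. \<Sum>v\<in>V. ?e i u v) + ?b i * (\<Sum>u\<in>V. \<Sum>v\<in>V. ?g i u v))"
    by (simp only: sum.distrib sum_distrib_left)
  also have "\<dots> \<le> (\<Sum>i\<le>d. ?a i * 2 + ?b i * 2)"
    by (intro sum_mono add_mono mult_left_mono sum_abs_edge_flow_le assms) auto
  also have "\<dots> = (\<Sum>i\<le>d. 1 / (real d + 1) * 2)"
    unfolding distrib_right[symmetric] by (intro sum.cong refl) (use polya_weights in auto)
  also have "\<dots> = 2" by (simp add: divide_simps)
  finally have tot: "(\<Sum>u\<in>V. \<Sum>v\<in>V. \<bar>polya_level f d u v\<bar>) \<le> 2" .
  have "energy_on V (polya_level f d) \<le> (\<Sum>u\<in>V. \<Sum>v\<in>V. 2 / (real d + 1) * \<bar>polya_level f d u v\<bar>)"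
    unfolding energy_on_def
  proof (intro sum_mono)
    fix u v
    have "(polya_level f d u v)^2 = \<bar>polya_level f d u v\<bar> * \<bar>polya_level f d u v\<bar>"
      by (simp add: power2_eq_square)
    also have "\<dots> \<le> 2 / (real d + 1) * \<bar>polya_level f d u v\<bar>"
      by (intro mult_right_mono max) auto
    finally show "(polya_level f d u v)^2 \<le> 2 / (real d + 1) * \<bar>polya_level f d u v\<bar>" .
  qed
  also have "\<dots> = 2 / (real d + 1) * (\<Sum>u\<in>V. \<Sum>v\<in>V. \<bar>polya_level f d u v\<bar>)"
    by (simp only: sum_distrib_left)
  also have "\<dots> \<le> 2 / (real d + 1) * 2"
    by (intro mult_left_mono tot) auto
  finally show ?thesis by simp
qed

text \<open>An edge of a level has an endpoint on the next antidiagonal, which no earlier level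
  reaches. This makes the supports of different levels disjoint.\<close>

lemma polya_level_nonzero:
  assumes "polya_level f d u v \<noteq> 0"
  shows "\<exists>i j. i + j = Suc d \<and> (u = f i j \<or> v = f i j)"
proof (rule ccontr)
  assume neg: "\<not> ?thesis"
  have "edge_flow (f i (d - i)) (f (Suc i) (d - i)) u v = 0 \<and> edge_flow (f i (d - i)) (f i (Suc (d - i))) u v = 0"
    if "i \<le> d" for i
  proof -
    have "Suc i + (d - i) = Suc d" "i + Suc (d - i) = Suc d" using that by auto
    with neg have "u \<noteq> f (Suc i) (d - i)" "v \<noteq> f (Suc i) (d - i)" "u \<noteq> f i (Suc (d - i))" "v \<noteq> f i (Suc (d - i))"
      by blast+
    then show ?thesis by (auto simp: edge_flow_def point_mass_def)
  qed
  then have "polya_level f d u v = 0"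
    unfolding polya_level_def by (intro sum.neutral) auto
  with assms show False by simp
qed

text \<open>At level \<open>d\<close> the unit of current is spread uniformly over the antidiagonal \<open>i + j = d\<close>;
  as in Polya's urn, moving from \<open>(i, j)\<close> to \<open>(i + 1, j)\<close> with probability \<open>(i + 1) / (d + 2)\<close>
  keeps it uniform.\<close>

lemma polya_flow:
  fixes f :: "nat \<Rightarrow> nat \<Rightarrow> 'a"
  assumes V: "finite V" "\<And>i j. i + j \<le> k \<Longrightarrow> f i j \<in> V"
    and inj: "\<And>i j i' j'. f i j = f i' j' \<Longrightarrow> i = i' \<and> j = j'"
    and E: "\<And>i j. E (f i j) (f (Suc i) j) \<and> E (f (Suc i) j) (f i j)"
      "\<And>i j. E (f i j) (f i (Suc j)) \<and> E (f i (Suc j)) (f i j)"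
  shows "\<exists>\<theta>. flow_on V E (\<lambda>v. point_mass (f 0 0) v - antidiag f k v) \<theta> \<and> energy_on V \<theta> \<le> 4 * harm k"
proof -
  \<comment> \<open>The clause on the support is carried through the induction so that each new
    level is disjoint from the flow built so far; the energies \<open>4 / (d + 1)\<close> then add
    up to a harmonic sum.\<close>
  have "\<exists>\<theta>. flow_on V E (\<lambda>v. point_mass (f 0 0) v - antidiag f k v) \<theta> \<and> energy_on V \<theta> \<le> 4 * harm k \<and>
      (\<forall>u v. \<theta> u v \<noteq> 0 \<longrightarrow> (\<exists>i j. i + j \<le> k \<and> u = f i j) \<and> (\<exists>i j. i + j \<le> k \<and> v = f i j))"
    using V(2)
  proof (induction k)
    case 0
    have "flow_on V E (\<lambda>v. point_mass (f 0 0) v - antidiag f 0 v) (\<lambda>_ _. 0)"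
      by (rule flow_on_cong[OF flow_on_zero]) (auto simp: antidiag_def)
    then show ?case
      by (intro exI[of _ "\<lambda>_ _. 0"]) (auto simp: energy_on_def harm_def)
  next
    case (Suc k)
    have "\<And>i j. i + j \<le> k \<Longrightarrow> f i j \<in> V" using Suc.prems by simp
    from Suc.IH[OF this] obtain \<theta> where \<theta>: "flow_on V E (\<lambda>v. point_mass (f 0 0) v - antidiag f k v) \<theta>"
      "energy_on V \<theta> \<le> 4 * harm k"
      "\<And>u v. \<theta> u v \<noteq> 0 \<Longrightarrow> (\<exists>i j. i + j \<le> k \<and> u = f i j) \<and> (\<exists>i j. i + j \<le> k \<and> v = f i j)"
      by blast
    let ?\<theta> = "\<lambda>u v. \<theta> u v + polya_level f k u v"
    have lv: "flow_on V E (\<lambda>v. antidiag f k v - antidiag f (Suc k) v) (polya_level f k)"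
      using V(1) Suc.prems E by (intro polya_level_flow) auto
    have "flow_on V E (\<lambda>v. point_mass (f 0 0) v - antidiag f (Suc k) v) ?\<theta>"
      by (rule flow_on_cong[OF flow_on_add[OF \<theta>(1) lv]]) auto
    moreover have "energy_on V ?\<theta> = energy_on V \<theta> + energy_on V (polya_level f k)"
    proof (rule energy_on_add_disjoint)
      fix u v
      show "\<theta> u v * polya_level f k u v = 0"
      proof (rule ccontr)
        assume "\<theta> u v * polya_level f k u v \<noteq> 0"
        then have nz: "\<theta> u v \<noteq> 0" "polya_level f k u v \<noteq> 0" by auto
        from polya_level_nonzero[OF nz(2)] obtain i j where ij: "i + j = Suc k" "u = f i j \<or> v = f i j" by blast
        with \<theta>(3)[OF nz(1)] obtain i' j' where "i' + j' \<le> k" "f i' j' = f i j" by metis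
        from inj[OF this(2)] this(1) ij(1) show False by simp
      qed
    qed
    moreover have "energy_on V (polya_level f k) \<le> 4 / (real k + 1)"
      by (rule polya_level_energy[OF V(1) inj])
    moreover have "4 * harm (Suc k) = 4 * harm k + 4 / (real k + 1)"
      by (simp add: harm_Suc field_simps)
    moreover have "(\<exists>i j. i + j \<le> Suc k \<and> u = f i j) \<and> (\<exists>i j. i + j \<le> Suc k \<and> v = f i j)" if "?\<theta> u v \<noteq> 0" for u v
    proof (cases "\<theta> u v = 0")
      case False
      then show ?thesis using \<theta>(3) le_SucI by metis
    next
      case True
      with that have nz: "polya_level f k u v \<noteq> 0" by simp
      have "\<exists>i\<le>k. edge_flow (f i (k - i)) (f (Suc i) (k - i)) u v \<noteq> 0 \<or> edge_flow (f i (k - i)) (f i (Suc (k - i))) u v \<noteq> 0"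
      proof (rule ccontr)
        assume "\<not> ?thesis"
        then have "polya_level f k u v = 0"
          unfolding polya_level_def by (intro sum.neutral) auto
        with nz show False by simp
      qed
      then obtain i where i: "i \<le> k" and e:
        "edge_flow (f i (k - i)) (f (Suc i) (k - i)) u v \<noteq> 0 \<or> edge_flow (f i (k - i)) (f i (Suc (k - i))) u v \<noteq> 0"
        by blast
      have le: "i + (k - i) \<le> Suc k" "Suc i + (k - i) \<le> Suc k" "i + Suc (k - i) \<le> Suc k"
        using i by auto
      show ?thesis
        using e
      proof (elim disjE)
        assume "edge_flow (f i (k - i)) (f (Suc i) (k - i)) u v \<noteq> 0"
        from edge_flow_nonzero[OF this] le show ?thesis by blast
      next
        assume "edge_flow (f i (k - i)) (f i (Suc (k - i))) u v \<noteq> 0"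
        from edge_flow_nonzero[OF this] le show ?thesis by blast
      qed
    qed
    ultimately show ?case using \<theta>(2) by (intro exI[of _ ?\<theta>]) auto
  qed
  then show ?thesis by blast
qed

section \<open>Logarithmic resistance of the square grid\<close>

definition cells :: "int \<Rightarrow> (int \<times> int) set" where
  "cells m = {0..<m} \<times> {0..<m}"

definition grid_adj :: "int \<times> int \<Rightarrow> int \<times> int \<Rightarrow> bool" where
  "grid_adj u v \<longleftrightarrow> \<bar>fst u - fst v\<bar> + \<bar>snd u - snd v\<bar> = 1"

text \<open>A resistance bound given by a witness, in the doubled normalisation of
  \<open>energy_on\<close>, so that no infimum has to be handled.\<close>

definition grid_res_le :: "int \<Rightarrow> int \<times> int \<Rightarrow> int \<times> int \<Rightarrow> real \<Rightarrow> bool" where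
  "grid_res_le m a b e \<longleftrightarrow> (\<exists>\<psi>. flow_on (cells m) grid_adj (\<lambda>v. point_mass a v - point_mass b v) \<psi> \<and>
     energy_on (cells m) \<psi> \<le> e)"

lemma finite_cells [simp]: "finite (cells m)"
  by (simp add: cells_def)

lemma mem_cells: "u \<in> cells m \<longleftrightarrow> 0 \<le> fst u \<and> fst u < m \<and> 0 \<le> snd u \<and> snd u < m"
  by (auto simp: cells_def mem_Times_iff)

text \<open>Adding flows stands in for the triangle inequality of resistances. The price is a factor
  2, affordable for boundedly many compositions.\<close>

lemma grid_res_le_trans:
  assumes "grid_res_le m a b e" "grid_res_le m b c e'"
  shows "grid_res_le m a c (2 * e + 2 * e')"
proof -
  obtain \<psi> \<psi>' where *: "flow_on (cells m) grid_adj (\<lambda>v. point_mass a v - point_mass b v) \<psi>" "energy_on (cells m) \<psi> \<le> e"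
    "flow_on (cells m) grid_adj (\<lambda>v. point_mass b v - point_mass c v) \<psi>'" "energy_on (cells m) \<psi>' \<le> e'"
    using assms unfolding grid_res_le_def by blast
  have "flow_on (cells m) grid_adj (\<lambda>v. point_mass a v - point_mass c v) (\<lambda>u v. \<psi> u v + \<psi>' u v)"
    by (rule flow_on_cong[OF flow_on_add[OF *(1,3)]]) auto
  moreover have "energy_on (cells m) (\<lambda>u v. \<psi> u v + \<psi>' u v) \<le> 2 * e + 2 * e'"
    using energy_on_add_le[of "cells m" \<psi> \<psi>'] *(2,4) by linarith
  ultimately show ?thesis unfolding grid_res_le_def by blast
qed

lemma grid_res_le_mono: "grid_res_le m a b e \<Longrightarrow> e \<le> e' \<Longrightarrow> grid_res_le m a b e'"
  unfolding grid_res_le_def by (meson order_trans)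

lemma grid_res_le_edge:
  assumes "a \<in> cells m" "b \<in> cells m" "grid_adj a b"
  shows "grid_res_le m a b 2"
proof -
  have "grid_adj b a" using assms(3) unfolding grid_adj_def by arith
  then have "flow_on (cells m) grid_adj (\<lambda>v. point_mass a v - point_mass b v) (edge_flow a b)"
    using assms by (intro flow_on_edge_flow) auto
  moreover have "energy_on (cells m) (edge_flow a b) \<le> 2"
  proof -
    have "(edge_flow a b u v)^2 \<le> \<bar>edge_flow a b u v\<bar>" for u v
      by (auto simp: edge_flow_def point_mass_def)
    then have "energy_on (cells m) (edge_flow a b) \<le> (\<Sum>u\<in>cells m. \<Sum>v\<in>cells m. \<bar>edge_flow a b u v\<bar>)"
      unfolding energy_on_def by (intro sum_mono)
    also have "\<dots> \<le> 2" by (rule sum_abs_edge_flow_le) simp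
    finally show ?thesis .
  qed
  ultimately show ?thesis unfolding grid_res_le_def by blast
qed

text \<open>Here \<open>a\<close> and \<open>b\<close> are opposite corners of a square. The urn
  flow from either corner becomes uniform on the diagonal through the other two corners, so the
  difference of the two flows leads from \<open>a\<close> to \<open>b\<close>.\<close>

lemma grid_res_le_square:
  assumes a: "a \<in> cells m" and b: "b \<in> cells m" and diag: "\<bar>fst b - fst a\<bar> = \<bar>snd b - snd a\<bar>"
  shows "grid_res_le m a b (16 * harm (nat \<bar>fst b - fst a\<bar>))"
proof -
  define k where "k = nat \<bar>fst b - fst a\<bar>"
  \<comment> \<open>The signs orient the square, so that one computation covers all four directions
    from \<open>a\<close> to \<open>b\<close>.\<close>
  define \<sigma> :: int where "\<sigma> = (if fst b \<ge> fst a then 1 else -1)"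
  define \<tau> :: int where "\<tau> = (if snd b \<ge> snd a then 1 else -1)"
  define f where "f = (\<lambda>i j :: nat. (fst a + \<sigma> * int i, snd a + \<tau> * int j))"
  define g where "g = (\<lambda>i j :: nat. (fst b - \<sigma> * int i, snd b - \<tau> * int j))"
  have st: "\<sigma> = 1 \<or> \<sigma> = -1" "\<tau> = 1 \<or> \<tau> = -1" by (auto simp: \<sigma>_def \<tau>_def)
  have bk: "fst b = fst a + \<sigma> * int k" "snd b = snd a + \<tau> * int k"
    using diag by (auto simp: \<sigma>_def \<tau>_def k_def)
  have in_f: "f i j \<in> cells m" and in_g: "g i j \<in> cells m" if "i + j \<le> k" for i j
    using a b bk st that unfolding f_def g_def mem_cells by auto
  have inj_f: "i = i' \<and> j = j'" if "f i j = f i' j'" for i j i' j'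
    using that st by (auto simp: f_def)
  have inj_g: "i = i' \<and> j = j'" if "g i j = g i' j'" for i j i' j'
    using that st by (auto simp: g_def)
  have adj_f: "grid_adj (f i j) (f (Suc i) j) \<and> grid_adj (f (Suc i) j) (f i j)"
      "grid_adj (f i j) (f i (Suc j)) \<and> grid_adj (f i (Suc j)) (f i j)" for i j
    using st by (auto simp: f_def grid_adj_def)
  have adj_g: "grid_adj (g i j) (g (Suc i) j) \<and> grid_adj (g (Suc i) j) (g i j)"
      "grid_adj (g i j) (g i (Suc j)) \<and> grid_adj (g i (Suc j)) (g i j)" for i j
    using st by (auto simp: g_def grid_adj_def)
  obtain \<theta> where \<theta>: "flow_on (cells m) grid_adj (\<lambda>v. point_mass (f 0 0) v - antidiag f k v) \<theta>"
      "energy_on (cells m) \<theta> \<le> 4 * harm k"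
    using polya_flow[of "cells m" k f grid_adj, OF finite_cells in_f inj_f adj_f] by blast
  obtain \<theta>' where \<theta>': "flow_on (cells m) grid_adj (\<lambda>v. point_mass (g 0 0) v - antidiag g k v) \<theta>'"
      "energy_on (cells m) \<theta>' \<le> 4 * harm k"
    using polya_flow[of "cells m" k g grid_adj, OF finite_cells in_g inj_g adj_g] by blast
  \<comment> \<open>Position \<open>i\<close> seen from \<open>b\<close> is position
    \<open>k - i\<close> seen from \<open>a\<close>.\<close>
  have ad: "antidiag g k v = antidiag f k v" for v
  proof -
    have "(\<Sum>i\<le>k. point_mass (g i (k - i)) v) = (\<Sum>i\<le>k. point_mass (f i (k - i)) v)"
    proof (rule sum.reindex_bij_witness[of _ "\<lambda>i. k - i" "\<lambda>i. k - i"])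
      fix i assume "i \<in> {..k}"
      then have "g i (k - i) = f (k - i) (k - (k - i))"
        by (auto simp: f_def g_def bk of_nat_diff algebra_simps)
      then show "point_mass (f (k - i) (k - (k - i))) v = point_mass (g i (k - i)) v" by simp
    qed auto
    then show ?thesis by (simp add: antidiag_def)
  qed
  have fa: "f 0 0 = a" "g 0 0 = b" by (auto simp: f_def g_def)
  let ?\<psi> = "\<lambda>u v. \<theta> u v + (-1) * \<theta>' u v"
  have "flow_on (cells m) grid_adj (\<lambda>v. point_mass a v - point_mass b v) ?\<psi>"
    by (rule flow_on_cong[OF flow_on_add[OF \<theta>(1) flow_on_scale[OF \<theta>'(1)]]]) (simp add: ad fa)
  moreover have "energy_on (cells m) ?\<psi> \<le> 16 * harm k"
    using energy_on_add_le[of "cells m" \<theta> "\<lambda>u v. (-1) * \<theta>' u v"] \<theta>(2) \<theta>'(2)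
      energy_on_scale[of "cells m" "-1" \<theta>'] by simp
  ultimately show ?thesis unfolding grid_res_le_def k_def by blast
qed

lemma harm_le_ln: "n > 0 \<Longrightarrow> harm n \<le> 1 + ln (real n)"
proof (induction n rule: nat_induct_non_zero)
  case 1
  show ?case by (simp add: harm_def)
next
  case (Suc n)
  have "ln (real n / real (Suc n)) \<le> real n / real (Suc n) - 1"
    using Suc by (intro ln_le_minus_one) auto
  also have "\<dots> = - inverse (real (Suc n))" by (simp add: field_simps)
  finally have "ln (real n) - ln (real (Suc n)) \<le> - inverse (real (Suc n))"
    using Suc by (simp add: ln_div)
  then show ?case using Suc unfolding harm_Suc by simp
qed

lemma harm_nat_le: "0 \<le> k \<Longrightarrow> k \<le> m \<Longrightarrow> harm (nat k) \<le> (harm (nat m) :: real)"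
  by (intro harm_mono) auto

text \<open>Even parity allows \<open>b\<close> to be reached from \<open>a\<close> by the diagonal
  moves \<open>(k, k)\<close> and \<open>(l, -l)\<close> in either order, each of them across a
  square. If both possible turning points left the grid, some coordinate of \<open>a\<close> and
  \<open>b\<close> would differ by more than the side of the grid.\<close>

lemma grid_res_le_even:
  assumes a: "a \<in> cells m" and b: "b \<in> cells m" and even: "even (fst b - fst a + (snd b - snd a))"
  shows "grid_res_le m a b (64 * harm (nat m))"
proof -
  obtain k where k: "fst b - fst a + (snd b - snd a) = 2 * k" using even by (rule evenE)
  define l where "l = fst b - fst a - k"
  have "(0 \<le> fst a + k \<and> fst a + k < m \<and> 0 \<le> snd a + k \<and> snd a + k < m) \<or>
     (0 \<le> fst a + l \<and> fst a + l < m \<and> 0 \<le> snd a - l \<and> snd a - l < m)"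
  proof -
    have "fst b = fst a + k + l" "snd b = snd a + k - l" using k by (auto simp: l_def)
    then show ?thesis using a b unfolding mem_cells by (smt (verit))
  qed
  then obtain w where w: "w \<in> cells m" "\<bar>fst w - fst a\<bar> = \<bar>snd w - snd a\<bar>" "\<bar>fst b - fst w\<bar> = \<bar>snd b - snd w\<bar>"
  proof (elim disjE)
    assume "0 \<le> fst a + k \<and> fst a + k < m \<and> 0 \<le> snd a + k \<and> snd a + k < m"
    then show thesis using k by (intro that[of "(fst a + k, snd a + k)"]) (auto simp: mem_cells)
  next
    assume "0 \<le> fst a + l \<and> fst a + l < m \<and> 0 \<le> snd a - l \<and> snd a - l < m"
    then show thesis using k by (intro that[of "(fst a + l, snd a - l)"]) (auto simp: mem_cells l_def)
  qed
  have le: "\<bar>fst w - fst a\<bar> \<le> m" "\<bar>fst b - fst w\<bar> \<le> m"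
    using w(1) a b by (auto simp: mem_cells)
  have "grid_res_le m a b (2 * (16 * harm (nat \<bar>fst w - fst a\<bar>)) + 2 * (16 * harm (nat \<bar>fst b - fst w\<bar>)))"
    by (intro grid_res_le_trans[of m a w] grid_res_le_square a b w)
  then show ?thesis
    by (rule grid_res_le_mono) (use harm_nat_le[OF _ le(1)] harm_nat_le[OF _ le(2)] in auto)
qed

lemma grid_res_le_ln:
  assumes a: "a \<in> cells m" and b: "b \<in> cells m" and m: "m \<ge> 2"
  shows "grid_res_le m a b (132 * (1 + ln (real_of_int m)))"
proof -
  have h: "harm (nat m) \<le> 1 + ln (real_of_int m)"
    using harm_le_ln[of "nat m"] m by simp
  have ln: "0 \<le> ln (real_of_int m)" using m by simp
  show ?thesis
  proof (cases "even (fst b - fst a + (snd b - snd a))")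
    case True
    then show ?thesis
      by (rule grid_res_le_mono[OF grid_res_le_even[OF a b]]) (use h ln in auto)
  next
    case False
    \<comment> \<open>For odd parity the target is replaced by a horizontal neighbour of
      \<open>b\<close>, for which \<open>m \<ge> 2\<close> leaves room. The constant is
      \<open>132 = 2 * 64 + 2 * 2\<close>.\<close>
    define w where "w = (if fst b = 0 then fst b + 1 else fst b - 1, snd b)"
    have w: "w \<in> cells m" "grid_adj w b" "even (fst w - fst a + (snd w - snd a))"
      using b m False by (auto simp: w_def mem_cells grid_adj_def)
    have "grid_res_le m a b (2 * (64 * harm (nat m)) + 2 * 2)"
      by (intro grid_res_le_trans[OF grid_res_le_even[OF a w(1,3)] grid_res_le_edge[OF w(1) b w(2)]])
    then show ?thesis
      by (rule grid_res_le_mono) (use h ln in auto)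
  qed
qed

section \<open>Good cells form a well connected set\<close>

text \<open>The shift by \<open>1\<close> accounts for the size of the cells: it makes every two points of the two cells
  lie within \<open>R\<close> cell sides of each other.\<close>

definition cell_near :: "int \<Rightarrow> int \<times> int \<Rightarrow> int \<times> int \<Rightarrow> bool" where
  "cell_near R u v \<longleftrightarrow> (\<bar>fst u - fst v\<bar> + 1)^2 + (\<bar>snd u - snd v\<bar> + 1)^2 \<le> R^2"

definition window :: "int \<Rightarrow> int \<Rightarrow> int \<times> int \<Rightarrow> (int \<times> int) set" where
  "window m K u = {v \<in> cells m. \<bar>fst v - fst u\<bar> \<le> K \<and> \<bar>snd v - snd u\<bar> \<le> K}"

text \<open>Row 0 is left out: a copy attached to a topmost cell then avoids the whole cluster, and
  the copies above the top and below the bottom are disjoint even for a cluster with a single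
  row.\<close>

definition half_disc :: "int \<Rightarrow> (int \<times> int) set" where
  "half_disc R = {u. 1 \<le> snd u \<and> cell_near R (0, 0) u}"

definition near_edge :: "int \<Rightarrow> int \<Rightarrow> int \<Rightarrow> bool" where
  "near_edge m K a \<longleftrightarrow> a < K \<or> m - K \<le> a"

lemma finite_window [simp]: "finite (window m K u)"
  unfolding window_def by simp

lemma card_window_le:
  assumes "K \<ge> 0"
  shows "card (window m K u) \<le> nat ((2 * K + 1)^2)"
proof -
  have "window m K u \<subseteq> {fst u - K..fst u + K} \<times> {snd u - K..snd u + K}"
    by (auto simp: window_def mem_Times_iff)
  then have "card (window m K u) \<le> card ({fst u - K..fst u + K} \<times> {snd u - K..snd u + K})"
    by (intro card_mono) auto
  also have "\<dots> = nat ((2 * K + 1)^2)"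
    using assms by (simp add: card_cartesian_product power2_eq_square nat_mult_distrib)
  finally show ?thesis .
qed

lemma cell_near_sym: "cell_near R u v = cell_near R v u"
  by (simp add: cell_near_def abs_minus_commute)

lemma cell_near_mono:
  assumes "cell_near R u v" "\<bar>fst u' - fst v'\<bar> \<le> \<bar>fst u - fst v\<bar>" "\<bar>snd u' - snd v'\<bar> \<le> \<bar>snd u - snd v\<bar>"
  shows "cell_near R u' v'"
proof -
  have "(\<bar>fst u' - fst v'\<bar> + 1)^2 \<le> (\<bar>fst u - fst v\<bar> + 1)^2" "(\<bar>snd u' - snd v'\<bar> + 1)^2 \<le> (\<bar>snd u - snd v\<bar> + 1)^2"
    using assms by (auto intro!: power_mono)
  then show ?thesis using assms(1) unfolding cell_near_def by linarith
qed

lemma cell_near_less: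
  assumes "cell_near R u v" "R > 0"
  shows "\<bar>fst u - fst v\<bar> < R" "\<bar>snd u - snd v\<bar> < R"
proof -
  have "(\<bar>fst u - fst v\<bar> + 1)^2 \<le> R^2" "(\<bar>snd u - snd v\<bar> + 1)^2 \<le> R^2"
    using assms(1) zero_le_power2[of "\<bar>fst u - fst v\<bar> + 1"] zero_le_power2[of "\<bar>snd u - snd v\<bar> + 1"]
    unfolding cell_near_def by linarith+
  then have "\<bar>fst u - fst v\<bar> + 1 \<le> R" "\<bar>snd u - snd v\<bar> + 1 \<le> R"
    using assms(2) power2_le_imp_le[of _ R] less_imp_le by blast+
  then show "\<bar>fst u - fst v\<bar> < R" "\<bar>snd u - snd v\<bar> < R" by auto
qed

lemma cell_near_adj:
  assumes "\<bar>fst u - fst v\<bar> + \<bar>snd u - snd v\<bar> \<le> 1" "R \<ge> 3"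
  shows "cell_near R u v"
proof -
  have "\<bar>fst u - fst v\<bar> \<le> 1" "\<bar>snd u - snd v\<bar> \<le> 1" using assms by auto
  then have "(\<bar>fst u - fst v\<bar> + 1)^2 \<le> 2^2" "(\<bar>snd u - snd v\<bar> + 1)^2 \<le> 2^2" "3^2 \<le> R^2"
    using assms(2) by (intro power_mono; simp)+
  then show ?thesis unfolding cell_near_def by simp
qed

lemma ex_maximum_int:
  fixes f :: "'a \<Rightarrow> int"
  assumes "finite S" "S \<noteq> {}"
  shows "\<exists>t\<in>S. \<forall>a\<in>S. f a \<le> f t"
proof -
  have "Max (f ` S) \<in> f ` S" using assms by simp
  then obtain t where "t \<in> S" "Max (f ` S) = f t" by blast
  then show ?thesis using assms by (metis Max_ge finite_imageI imageI)
qed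

lemma half_disc_finite: "R > 0 \<Longrightarrow> finite (half_disc R)"
proof -
  assume R: "R > 0"
  have "half_disc R \<subseteq> {-R..R} \<times> {-R..R}"
  proof
    fix x assume "x \<in> half_disc R"
    then have "cell_near R (0, 0) x" by (simp add: half_disc_def)
    from cell_near_less[OF this R] show "x \<in> {-R..R} \<times> {-R..R}"
      unfolding mem_Times_iff atLeastAtMost_iff by auto
  qed
  then show ?thesis by (rule finite_subset) simp
qed

text \<open>The deterministic content of the random event. With
  \<open>h = card (half_disc R)\<close>, the bounds \<open>2h\<close>, \<open>h\<close> and none
  correspond to two half discs, one half disc and a single cell. \<open>K_ge\<close> gives a window
  room for a start within \<open>R + 1\<close> of its centre, a cluster of extent \<open>s\<close>
  around that start and one further step; \<open>m_ge\<close> keeps opposite margins apart.\<close>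

locale sparse_bad_cells =
  fixes m R K :: int and g :: "int \<times> int \<Rightarrow> bool"
  assumes R3: "R \<ge> 3"
    and K_ge: "K \<ge> 2 * int (card (half_disc R)) + 2 * R + 1"
    and m_ge: "m \<ge> 2 * K + 2"
    and bulk: "\<And>v. v \<in> cells m \<Longrightarrow> card {w \<in> window m K v. \<not> g w} < 2 * card (half_disc R)"
    and side: "\<And>v. v \<in> cells m \<Longrightarrow> near_edge m K (fst v) \<or> near_edge m K (snd v) \<Longrightarrow>
        card {w \<in> window m K v. \<not> g w} < card (half_disc R)"
    and corner: "\<And>v w. v \<in> cells m \<Longrightarrow> near_edge m K (fst v) \<Longrightarrow> near_edge m K (snd v) \<Longrightarrow> w \<in> window m K v \<Longrightarrow> g w"
begin

text \<open>A window has fewer than \<open>s\<close> bad cells, so \<open>s\<close> consecutive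
  lines include one without bad cells; \<open>s\<close> thereby also bounds the extent of a cluster
  that avoids such lines.\<close>

abbreviation "s \<equiv> 2 * int (card (half_disc R))"

lemma card_half_disc_le:
  assumes inj: "inj F" and F: "\<And>x. x \<in> half_disc R \<Longrightarrow> F x \<in> {w \<in> window m K v. \<not> g w}"
  shows "card (half_disc R) \<le> card {w \<in> window m K v. \<not> g w}"
proof -
  have "card (half_disc R) = card (F ` half_disc R)"
    using inj by (simp add: card_image inj_on_subset)
  also have "\<dots> \<le> card {w \<in> window m K v. \<not> g w}"
    using F by (intro card_mono) auto
  finally show ?thesis .
qed

text \<open>If \<open>S\<close> had no good neighbour, the half discs above its topmost and below its bottommost
  cell would consist of bad cells, which are too many; near one side of the grid a single half disc
  pointing away from that side suffices.\<close>

lemma escape: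
  assumes v: "v \<in> cells m" and S: "S \<subseteq> window m s v" "S \<noteq> {}"
  shows "\<exists>a\<in>S. \<exists>w\<in>cells m - S. g w \<and> cell_near R a w"
proof (rule ccontr)
  assume "\<not> ?thesis"
  then have neg: "\<not> g w" if "a \<in> S" "w \<in> cells m" "w \<notin> S" "cell_near R a w" for a w
    using that by blast
  have fin: "finite S" by (rule finite_subset[OF S(1) finite_window])
  obtain t where t: "t \<in> S" "\<And>a. a \<in> S \<Longrightarrow> snd a \<le> snd t"
    using ex_maximum_int[OF fin S(2), of snd] by blast
  obtain b where b: "b \<in> S" "\<And>a. a \<in> S \<Longrightarrow> snd a \<ge> snd b"
    using ex_maximum_int[OF fin S(2), of "\<lambda>x. - snd x"] unfolding neg_le_iff_le by blast
  obtain r where r: "r \<in> S" "\<And>a. a \<in> S \<Longrightarrow> fst a \<le> fst r"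
    using ex_maximum_int[OF fin S(2), of fst] by blast
  obtain l where l: "l \<in> S" "\<And>a. a \<in> S \<Longrightarrow> fst a \<ge> fst l"
    using ex_maximum_int[OF fin S(2), of "\<lambda>x. - fst x"] unfolding neg_le_iff_le by blast
  have Sw: "a \<in> cells m \<and> \<bar>fst a - fst v\<bar> \<le> s \<and> \<bar>snd a - snd v\<bar> \<le> s" if "a \<in> S" for a
    using S(1) that unfolding window_def by blast
  have bad: "w \<in> {w \<in> window m K v. \<not> g w}" if "a \<in> S" "w \<in> cells m" "w \<notin> S" "cell_near R a w" for a w
    using neg[OF that] Sw[OF that(1)] cell_near_less[OF that(4)] R3 K_ge that(2) unfolding window_def by auto
  have hd: "1 \<le> snd x" "\<bar>fst x\<bar> < R" "snd x < R" "cell_near R (0, 0) x" if "x \<in> half_disc R" for x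
    using that cell_near_less[of R "(0,0)" x] R3 by (auto simp: half_disc_def)
  \<comment> \<open>The half disc is attached to the extreme cells of \<open>S\<close> in all four
    directions; to the right and to the left it is turned by exchanging the coordinates.\<close>
  let ?U = "\<lambda>x. (fst t + fst x, snd t + snd x)"
  let ?D = "\<lambda>x. (fst b + fst x, snd b - snd x)"
  let ?R = "\<lambda>x. (fst r + snd x, snd r + fst x)"
  let ?L = "\<lambda>x. (fst l - snd x, snd l + fst x)"
  have inj: "inj ?U" "inj ?D" "inj ?R" "inj ?L" by (auto simp: inj_def prod_eq_iff)
  have tr: "cell_near R t (?U x)" "cell_near R b (?D x)" "cell_near R r (?R x)" "cell_near R l (?L x)"
    if "x \<in> half_disc R" for x
    using hd(4)[OF that] unfolding cell_near_def by (simp_all add: add.commute)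
  have U: "?U x \<in> {w \<in> window m K v. \<not> g w}" if "x \<in> half_disc R" "?U x \<in> cells m" for x
    by (rule bad[OF t(1) that(2) _ tr(1)[OF that(1)]]) (use t(2)[of "?U x"] hd(1)[OF that(1)] in auto)
  have D: "?D x \<in> {w \<in> window m K v. \<not> g w}" if "x \<in> half_disc R" "?D x \<in> cells m" for x
    by (rule bad[OF b(1) that(2) _ tr(2)[OF that(1)]]) (use b(2)[of "?D x"] hd(1)[OF that(1)] in auto)
  have Ri: "?R x \<in> {w \<in> window m K v. \<not> g w}" if "x \<in> half_disc R" "?R x \<in> cells m" for x
    by (rule bad[OF r(1) that(2) _ tr(3)[OF that(1)]]) (use r(2)[of "?R x"] hd(1)[OF that(1)] in auto)
  have Le: "?L x \<in> {w \<in> window m K v. \<not> g w}" if "x \<in> half_disc R" "?L x \<in> cells m" for x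
    by (rule bad[OF l(1) that(2) _ tr(4)[OF that(1)]]) (use l(2)[of "?L x"] hd(1)[OF that(1)] in auto)
  have Sb: "fst v - s \<le> fst a" "fst a \<le> fst v + s" "snd v - s \<le> snd a" "snd a \<le> snd v + s"
      "0 \<le> fst a" "fst a < m" "0 \<le> snd a" "snd a < m" if "a \<in> S" for a
    using Sw[OF that] unfolding mem_cells by auto
  have hb: "1 \<le> snd x" "snd x < R" "- R < fst x" "fst x < R" if "x \<in> half_disc R" for x
    using hd[OF that] by auto
  consider "near_edge m K (fst v)" "near_edge m K (snd v)"
    | "near_edge m K (fst v)" "\<not> near_edge m K (snd v)"
    | "\<not> near_edge m K (fst v)" "near_edge m K (snd v)"
    | "\<not> near_edge m K (fst v)" "\<not> near_edge m K (snd v)" by blast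
  then show False
  proof cases
    \<comment> \<open>Near a corner the whole window is good, so the cell next to an extreme cell of
      \<open>S\<close> already gives the contradiction.\<close>
    case 1
    show False
    proof (cases "fst v < K")
      case True
      let ?w = "(fst r + 1, snd r)"
      have w: "?w \<in> cells m" using Sb[OF r(1)] True K_ge m_ge R3 unfolding mem_cells fst_conv snd_conv by linarith
      have "?w \<notin> S" using r(2)[of ?w] by auto
      then have "?w \<in> {w \<in> window m K v. \<not> g w}"
        by (rule bad[OF r(1) w]) (use R3 in \<open>auto intro!: cell_near_adj\<close>)
      with corner[OF v 1] show False by blast
    next
      case False
      let ?w = "(fst l - 1, snd l)"
      have w: "?w \<in> cells m" using Sb[OF l(1)] False K_ge m_ge R3 1 unfolding mem_cells near_edge_def fst_conv snd_conv by linarith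
      have "?w \<notin> S" using l(2)[of ?w] by auto
      then have "?w \<in> {w \<in> window m K v. \<not> g w}"
        by (rule bad[OF l(1) w]) (use R3 in \<open>auto intro!: cell_near_adj\<close>)
      with corner[OF v 1] show False by blast
    qed
  next
    case 2
    have "card (half_disc R) \<le> card {w \<in> window m K v. \<not> g w}"
    proof (cases "fst v < K")
      case True
      have "?R x \<in> cells m" if "x \<in> half_disc R" for x
        using Sb[OF r(1)] hb[OF that] True K_ge m_ge 2 unfolding mem_cells near_edge_def fst_conv snd_conv by linarith
      then show ?thesis by (intro card_half_disc_le[OF inj(3) Ri])
    next
      case False
      have "?L x \<in> cells m" if "x \<in> half_disc R" for x
        using Sb[OF l(1)] hb[OF that] False K_ge m_ge 2 unfolding mem_cells near_edge_def fst_conv snd_conv by linarith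
      then show ?thesis by (intro card_half_disc_le[OF inj(4) Le])
    qed
    with side[OF v] 2 show False by force
  next
    case 3
    have "card (half_disc R) \<le> card {w \<in> window m K v. \<not> g w}"
    proof (cases "snd v < K")
      case True
      have "?U x \<in> cells m" if "x \<in> half_disc R" for x
        using Sb[OF t(1)] hb[OF that] True K_ge m_ge 3 unfolding mem_cells near_edge_def fst_conv snd_conv by linarith
      then show ?thesis by (intro card_half_disc_le[OF inj(1) U])
    next
      case False
      have "?D x \<in> cells m" if "x \<in> half_disc R" for x
        using Sb[OF b(1)] hb[OF that] False K_ge m_ge 3 unfolding mem_cells near_edge_def fst_conv snd_conv by linarith
      then show ?thesis by (intro card_half_disc_le[OF inj(2) D])
    qed
    with side[OF v] 3 show False by force
  next
    case 4
    have cU: "?U x \<in> cells m" and cD: "?D x \<in> cells m" if "x \<in> half_disc R" for x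
      using Sb[OF t(1)] Sb[OF b(1)] K_ge m_ge 4 hb[OF that] unfolding mem_cells near_edge_def fst_conv snd_conv by linarith+
    have disj: "?U ` half_disc R \<inter> ?D ` half_disc R = {}"
    proof (rule equals0I)
      fix y assume "y \<in> ?U ` half_disc R \<inter> ?D ` half_disc R"
      then obtain x x' where x: "x \<in> half_disc R" "x' \<in> half_disc R" "?U x = ?D x'" by auto
      then show False
        using t(2)[OF b(1)] hb(1)[OF x(1)] hb(1)[OF x(2)] by simp
    qed
    have f: "finite (half_disc R)" using R3 by (intro half_disc_finite) auto
    have "2 * card (half_disc R) = card (?U ` half_disc R) + card (?D ` half_disc R)"
      using inj by (simp add: card_image inj_on_subset)
    also have "\<dots> = card (?U ` half_disc R \<union> ?D ` half_disc R)"
      using disj f by (subst card_Un_disjoint) auto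
    also have "\<dots> \<le> card {w \<in> window m K v. \<not> g w}"
    proof (rule card_mono)
      show "?U ` half_disc R \<union> ?D ` half_disc R \<subseteq> {w \<in> window m K v. \<not> g w}"
        using U[OF _ cU] D[OF _ cD] by blast
    qed simp
    finally show False using bulk[OF v] by simp
  qed
qed

section \<open>Walks through good cells that stay inside a window\<close>

definition step :: "int \<times> int \<Rightarrow> ((int \<times> int) \<times> (int \<times> int)) set" where
  "step u = {(v, w). v \<in> window m K u \<and> w \<in> window m K u \<and> g v \<and> g w \<and> cell_near R v w}"

text \<open>With \<open>\<pi>\<close> equal to \<open>fst\<close> or \<open>snd\<close>, columns and
  rows share one treatment. A line that misses the window is vacuously good, so \<open>r\<close> has
  to be sought where lines do meet it.\<close>

definition good_line :: "int \<times> int \<Rightarrow> (int \<times> int \<Rightarrow> int) \<Rightarrow> int \<Rightarrow> bool" where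
  "good_line u \<pi> r \<longleftrightarrow> (\<forall>w\<in>window m K u. \<pi> w = r \<longrightarrow> g w)"

lemma step_rtrancl_sym: "(v, w) \<in> (step u)\<^sup>* \<Longrightarrow> (w, v) \<in> (step u)\<^sup>*"
proof -
  have "sym (step u)" by (auto simp: step_def sym_def cell_near_sym)
  then show "(v, w) \<in> (step u)\<^sup>* \<Longrightarrow> (w, v) \<in> (step u)\<^sup>*"
    using sym_rtrancl symD by metis
qed

text \<open>Each line that fails contains a bad cell, and \<open>\<pi>\<close> tells these cells
  apart; \<open>s\<close> failing lines would violate \<open>bulk\<close>.\<close>

lemma ex_good_line:
  assumes u: "u \<in> cells m"
  shows "\<exists>r\<in>{lo..<lo + s}. good_line u \<pi> r"
proof (rule ccontr)
  assume "\<not> ?thesis"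
  then have "\<forall>r\<in>{lo..<lo + s}. \<exists>w. w \<in> window m K u \<and> \<pi> w = r \<and> \<not> g w"
    unfolding good_line_def by blast
  then obtain f where f: "\<And>r. r \<in> {lo..<lo + s} \<Longrightarrow> f r \<in> window m K u \<and> \<pi> (f r) = r \<and> \<not> g (f r)"
    by metis
  have "inj_on f {lo..<lo + s}"
    by (rule inj_on_inverseI[of _ \<pi>]) (use f in blast)
  then have "card {lo..<lo + s} = card (f ` {lo..<lo + s})" by (simp only: card_image)
  also have "\<dots> \<le> card {w \<in> window m K u. \<not> g w}"
    using f by (intro card_mono) auto
  finally show False using bulk[OF u] by simp
qed

lemma line_connected:
  assumes \<pi>: "\<pi> = fst \<or> \<pi> = snd" and line: "good_line u \<pi> r"
    and "v \<in> window m K u" "w \<in> window m K u" "\<pi> v = r" "\<pi> w = r"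
  shows "(v, w) \<in> (step u)\<^sup>*"
  using assms(3-)
proof (induction "nat (\<bar>fst v - fst w\<bar> + \<bar>snd v - snd w\<bar>)" arbitrary: v)
  case 0
  then have "v = w" by (auto simp: prod_eq_iff)
  then show ?case by simp
next
  case (Suc n)
  define x where "x = (fst v + sgn (fst w - fst v), snd v + sgn (snd w - snd v))"
  have one: "fst v = fst w \<or> snd v = snd w" using \<pi> Suc.prems by auto
  have x: "x \<in> window m K u" "\<pi> x = r" "\<bar>fst v - fst x\<bar> + \<bar>snd v - snd x\<bar> \<le> 1"
  proof -
    have "min (fst v) (fst w) \<le> fst x \<and> fst x \<le> max (fst v) (fst w)"
      "min (snd v) (snd w) \<le> snd x \<and> snd x \<le> max (snd v) (snd w)"
      by (auto simp: x_def sgn_if)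
    then show "x \<in> window m K u"
      using Suc.prems(1,2) unfolding window_def mem_cells mem_Collect_eq by linarith
    show "\<pi> x = r" using \<pi> Suc.prems(3,4) by (auto simp: x_def)
    show "\<bar>fst v - fst x\<bar> + \<bar>snd v - snd x\<bar> \<le> 1"
      using one by (elim disjE) (simp_all add: x_def sgn_if)
  qed
  have "n = nat (\<bar>fst x - fst w\<bar> + \<bar>snd x - snd w\<bar>)"
    using Suc.hyps(2) one by (elim disjE) (simp_all add: x_def sgn_if, arith+)
  then have "(x, w) \<in> (step u)\<^sup>*" using Suc.hyps(1) Suc.prems x by blast
  moreover have "(v, x) \<in> step u"
    using line Suc.prems x cell_near_adj[OF x(3) R3] unfolding step_def good_line_def by blast
  ultimately show ?case by (rule converse_rtrancl_into_rtrancl[rotated])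
qed

text \<open>A step may jump over the line. The cell of the line opposite the last cell before the
  jump is no farther away in either coordinate than the landing cell, and it is good, so the walk
  can stop on the line instead.\<close>

lemma line_crossed:
  assumes \<pi>: "\<pi> = fst \<or> \<pi> = snd" and line: "good_line u \<pi> r"
    and v: "v \<in> window m K u" "\<pi> v \<le> r" and w: "(v, w) \<in> (step u)\<^sup>*" "r \<le> \<pi> w"
  shows "\<exists>x\<in>window m K u. \<pi> x = r \<and> (v, x) \<in> (step u)\<^sup>*"
  using w
proof (induction rule: rtrancl_induct)
  case base
  then show ?case using v by (intro bexI[of _ v]) auto
next
  case (step y z)
  show ?case
  proof (cases "r \<le> \<pi> y")
    case False
    define x where "x = (if \<pi> = fst then (r, snd y) else (fst y, r))"
    have yz: "y \<in> window m K u" "z \<in> window m K u" "g y" "cell_near R y z"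
      using step.hyps(2) by (auto simp: step_def)
    have ne: "(fst :: int \<times> int \<Rightarrow> int) \<noteq> snd" by (metis fst_conv snd_conv zero_neq_one)
    have x: "x \<in> window m K u" "\<pi> x = r"
      using \<pi> yz(1,2) False step.prems by (auto simp: x_def window_def mem_cells ne)
    have "cell_near R y x"
      by (rule cell_near_mono[OF yz(4)]) (use \<pi> False step.prems in \<open>auto simp: x_def ne\<close>)
    then have "(y, x) \<in> step u"
      using yz x line by (auto simp: step_def good_line_def)
    then have "(v, x) \<in> (step u)\<^sup>*" using step.hyps(1) by (rule rtrancl_into_rtrancl[rotated])
    then show ?thesis using x by blast
  qed (use step.IH in blast)
qed

text \<open>The crossing of a good column and a good row serves as hub \<open>c\<close>. If a cell
  is not linked to it, the set \<open>S\<close> reachable from that cell meets no good line, so it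
  has extent at most \<open>s\<close> in both directions, and \<open>escape\<close> yields a good
  cell near \<open>S\<close> that still lies in the window. The radius \<open>R + 1\<close> admits
  the stand-ins of \<open>u\<close> and of its grid neighbours.\<close>

lemma good_cells_connected:
  assumes u: "u \<in> cells m"
  shows "\<exists>c. \<forall>v\<in>window m (R + 1) u. g v \<longrightarrow> (v, c) \<in> (step u)\<^sup>*"
proof -
  let ?W = "window m K u"
  have s_le: "s \<le> K" "s \<le> m" "0 \<le> s" using K_ge R3 m_ge by auto
  \<comment> \<open>Starting at \<open>min (fst u) (m - s)\<close> keeps the \<open>s\<close>
    candidates inside the grid and within \<open>K\<close> of \<open>u\<close>, so that the good
    line really meets the window.\<close>
  obtain c0 where c0: "c0 \<in> {min (fst u) (m - s)..<min (fst u) (m - s) + s}" "good_line u fst c0"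
    using ex_good_line[OF u] by blast
  obtain r0 where r0: "r0 \<in> {min (snd u) (m - s)..<min (snd u) (m - s) + s}" "good_line u snd r0"
    using ex_good_line[OF u] by blast
  have hub: "(c0, r0) \<in> ?W"
    using c0(1) r0(1) u s_le by (auto simp: window_def mem_cells)
  have rect: "(fst x, snd y) \<in> ?W" if "x \<in> ?W" "y \<in> ?W" for x y
    using that by (auto simp: window_def mem_cells)
  have to_hub: "(x, (c0, r0)) \<in> (step u)\<^sup>*"
    if "\<pi> = fst \<or> \<pi> = snd" "good_line u \<pi> (\<pi> x)" "x \<in> ?W" for x \<pi>
    using that(1)
  proof
    assume "\<pi> = fst"
    then have "(x, (fst x, r0)) \<in> (step u)\<^sup>*"
      using that rect[OF that(3) hub] by (intro line_connected[of fst u "fst x"]) auto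
    moreover have "((fst x, r0), (c0, r0)) \<in> (step u)\<^sup>*"
      using r0 hub rect[OF that(3) hub] by (intro line_connected[of snd u r0]) auto
    ultimately show ?thesis by simp
  next
    assume "\<pi> = snd"
    then have "(x, (c0, snd x)) \<in> (step u)\<^sup>*"
      using that rect[OF hub that(3)] by (intro line_connected[of snd u "snd x"]) auto
    moreover have "((c0, snd x), (c0, r0)) \<in> (step u)\<^sup>*"
      using c0 hub rect[OF hub that(3)] by (intro line_connected[of fst u c0]) auto
    ultimately show ?thesis by simp
  qed
  have "(v, (c0, r0)) \<in> (step u)\<^sup>*" if v: "v \<in> window m (R + 1) u" "g v" for v
  proof (rule ccontr)
    assume no: "(v, (c0, r0)) \<notin> (step u)\<^sup>*"
    define S where "S = {w. (v, w) \<in> (step u)\<^sup>*}"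
    have vc: "v \<in> cells m" and vW: "v \<in> ?W"
      using v(1) K_ge R3 unfolding window_def mem_Collect_eq by linarith+
    have SW: "w \<in> ?W \<and> g w" if "w \<in> S" for w
    proof -
      from that have "(v, w) \<in> (step u)\<^sup>*" by (simp add: S_def)
      then show ?thesis using vW v(2) by (cases rule: rtrancl.cases) (auto simp: step_def)
    qed
    have dist: "\<bar>\<pi> w - \<pi> v\<bar> \<le> s" if \<pi>: "\<pi> = fst \<or> \<pi> = snd" and w: "w \<in> S" for \<pi> w
    proof (rule ccontr)
      assume far: "\<not> \<bar>\<pi> w - \<pi> v\<bar> \<le> s"
      have vw: "(v, w) \<in> (step u)\<^sup>*" using w by (simp add: S_def)
      \<comment> \<open>As the distance exceeds \<open>s\<close>, these \<open>s\<close> lines lie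
        between \<open>v\<close> and \<open>w\<close>, and the walk has to cross the good
        one.\<close>
      obtain r where r: "r \<in> {min (\<pi> v) (\<pi> w)..<min (\<pi> v) (\<pi> w) + s}" "good_line u \<pi> r"
        using ex_good_line[OF u] by blast
      have "\<exists>x\<in>?W. \<pi> x = r \<and> (v, x) \<in> (step u)\<^sup>*"
      proof (cases "\<pi> v \<le> \<pi> w")
        case True
        then show ?thesis using r far by (intro line_crossed[OF \<pi> r(2) vW _ vw]) auto
      next
        case False
        have "\<exists>x\<in>?W. \<pi> x = r \<and> (w, x) \<in> (step u)\<^sup>*"
          using r far False SW[OF w] by (intro line_crossed[OF \<pi> r(2) _ _ step_rtrancl_sym[OF vw]]) auto
        then show ?thesis using vw by (meson rtrancl_trans)
      qed
      then obtain x where "x \<in> ?W" "\<pi> x = r" "(v, x) \<in> (step u)\<^sup>*" by blast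
      with to_hub[OF \<pi>, of x] r(2) no show False by (meson rtrancl_trans)
    qed
    have "S \<subseteq> window m s v"
      using dist[of fst] dist[of snd] SW by (auto simp: window_def)
    moreover have "v \<in> S" by (simp add: S_def)
    ultimately obtain a w where aw: "a \<in> S" "w \<in> cells m" "w \<notin> S" "g w" "cell_near R a w"
      using escape[OF vc] by blast
    \<comment> \<open>The distances add up to at most \<open>(R + 1) + s + (R - 1)\<close>; this is
      where the size of \<open>K\<close> comes from.\<close>
    have "\<bar>fst w - fst u\<bar> \<le> K \<and> \<bar>snd w - snd u\<bar> \<le> K"
    proof -
      have "R > 0" using R3 by simp
      then show ?thesis
        using dist[OF disjI1[OF refl] aw(1)] dist[OF disjI2[OF refl] aw(1)] cell_near_less[OF aw(5)] v(1) K_ge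
        unfolding window_def mem_Collect_eq by linarith
    qed
    then have "w \<in> ?W" using aw(2) by (simp add: window_def)
    then have "(a, w) \<in> step u" using aw SW[OF aw(1)] by (simp add: step_def)
    then have "w \<in> S" using aw(1) unfolding S_def by (simp add: rtrancl.rtrancl_into_rtrancl)
    with aw(3) show False by simp
  qed
  then show ?thesis by blast
qed

text \<open>\<open>escape\<close> for a cluster of one cell, be it good or bad. That
  \<open>w\<close> differs from \<open>u\<close> later keeps a vertex apart from the points to which
  it is joined.\<close>

lemma ex_good_neighbour:
  assumes u: "u \<in> cells m"
  shows "\<exists>w\<in>cells m. w \<noteq> u \<and> g w \<and> cell_near R u w"
proof -
  have "{u} \<subseteq> window m s u" using u by (simp add: window_def)
  from escape[OF u this] show ?thesis by blast
qed

end

section \<open>From the grid to the graph\<close>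

text \<open>Geometry and probability are left behind: the graph enters through the adjacency of
  points in near cells, and randomness through the sparseness of cells with fewer than
  \<open>k\<close> points.\<close>

locale cell_config =
  fixes m R K :: int and N :: nat and adj :: "nat \<Rightarrow> nat \<Rightarrow> bool" and cell :: "nat \<Rightarrow> int \<times> int" and k :: nat
  assumes sparse: "sparse_bad_cells m R K (\<lambda>a. k \<le> card {i. i < N \<and> cell i = a})"
    and k_pos: "k \<ge> 1"
    and cell_in: "\<And>i. i < N \<Longrightarrow> cell i \<in> cells m"
    and adjI: "\<And>i j. i < N \<Longrightarrow> j < N \<Longrightarrow> i \<noteq> j \<Longrightarrow> cell_near R (cell i) (cell j) \<Longrightarrow> adj i j"

sublocale cell_config \<subseteq> sparse_bad_cells m R K "\<lambda>a. k \<le> card {i. i < N \<and> cell i = a}"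
  by (rule sparse)

context cell_config
begin

abbreviation "good a \<equiv> k \<le> card {i. i < N \<and> cell i = a}"

text \<open>Selecting exactly \<open>k\<close> points makes the currents between near cells uniform,
  however crowded the cells are. The selection is meaningful for good cells.\<close>

definition reps :: "int \<times> int \<Rightarrow> nat set" where
  "reps a = (SOME T. T \<subseteq> {i. i < N \<and> cell i = a} \<and> card T = k)"

definition spread :: "int \<times> int \<Rightarrow> nat \<Rightarrow> real" where
  "spread a i = of_bool (i \<in> reps a) / k"

text \<open>A bound for the number of cells in a window of radius \<open>K + 1\<close>; the
  additional 1 is for the second endpoint of a grid edge.\<close>

definition W :: nat where "W = nat ((2 * K + 3)^2)"

lemma reps:
  assumes "good a"
  shows "reps a \<subseteq> {i. i < N \<and> cell i = a}" "card (reps a) = k"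
proof -
  have "\<exists>T. T \<subseteq> {i. i < N \<and> cell i = a} \<and> card T = k"
    using obtain_subset_with_card_n[OF assms] by metis
  from someI_ex[OF this] show "reps a \<subseteq> {i. i < N \<and> cell i = a}" "card (reps a) = k"
    unfolding reps_def by auto
qed

lemma sum_reps:
  assumes "good a"
  shows "(\<Sum>j<N. of_bool (j \<in> reps a)) = real k"
proof -
  have "{..<N} \<inter> reps a = reps a" using reps(1)[OF assms] by auto
  then show ?thesis
    using reps(2)[OF assms] by (simp add: of_bool_def sum.If_cases Collect_mem_eq)
qed

lemma finite_reps: "good a \<Longrightarrow> finite (reps a)"
  by (rule finite_subset[OF reps(1)]) auto

text \<open>Each of the \<open>k^2\<close> pairs of selected points carries current
  \<open>1 / k^2\<close>. For \<open>a = b\<close> the two products cancel and the flow is zero;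
  otherwise the selected sets are disjoint, so no loop carries current.\<close>

lemma flow_between_cells:
  assumes g: "good a" "good b" and near: "cell_near R a b"
  shows "\<exists>\<theta>. flow_on {..<N} adj (\<lambda>v. spread a v - spread b v) \<theta> \<and> (\<forall>i j. \<bar>\<theta> i j\<bar> \<le> 1 / k^2) \<and>
     (\<forall>i j. \<theta> i j \<noteq> 0 \<longrightarrow> i \<in> reps a \<union> reps b \<and> j \<in> reps a \<union> reps b)"
proof -
  define \<theta> where "\<theta> i j = (of_bool (i \<in> reps a) * of_bool (j \<in> reps b) - of_bool (i \<in> reps b) * of_bool (j \<in> reps a)) / (real k)^2" for i j
  have "flow_on {..<N} adj (\<lambda>v. spread a v - spread b v) \<theta>"
    unfolding flow_on_def
  proof (intro conjI allI impI ballI)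
    show "\<theta> i j = - \<theta> j i" for i j
      unfolding \<theta>_def by (simp add: mult.commute flip: minus_divide_left)
    show "\<theta> i j = 0" if "\<not> (i \<in> {..<N} \<and> j \<in> {..<N} \<and> adj i j)" for i j
    proof (rule ccontr)
      assume nz: "\<theta> i j \<noteq> 0"
      then have ab: "i \<in> reps a \<and> j \<in> reps b \<or> i \<in> reps b \<and> j \<in> reps a" "a \<noteq> b"
        unfolding \<theta>_def by auto
      then have "i < N" "j < N" "i \<noteq> j" "cell_near R (cell i) (cell j)"
        using reps(1)[OF g(1)] reps(1)[OF g(2)] near cell_near_sym[of R a b] by auto
      with adjI that show False by blast
    qed
    show "(\<Sum>j<N. \<theta> i j) = spread a i - spread b i" for i
      unfolding \<theta>_def spread_def sum_divide_distrib[symmetric] sum_subtractf sum_distrib_left[symmetric]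
        sum_reps[OF g(1)] sum_reps[OF g(2)]
      using k_pos by (simp add: field_simps power2_eq_square)
  qed
  moreover have "\<bar>\<theta> i j\<bar> \<le> 1 / k^2" for i j
  proof -
    have "\<bar>of_bool (i \<in> reps a) * of_bool (j \<in> reps b) - of_bool (i \<in> reps b) * of_bool (j \<in> reps a)\<bar> \<le> (1 :: real)"
      by auto
    from divide_right_mono[OF this, of "(real k)^2"] show ?thesis by (simp add: \<theta>_def)
  qed
  moreover have "i \<in> reps a \<union> reps b \<and> j \<in> reps a \<union> reps b" if "\<theta> i j \<noteq> 0" for i j
    using that unfolding \<theta>_def by auto
  ultimately show ?thesis by blast
qed

definition window_reps :: "int \<times> int \<Rightarrow> nat set" where
  "window_reps u = (\<Union>a\<in>{a \<in> window m K u. good a}. reps a)"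

text \<open>Only the largest value on an edge is tracked, since a walk may use the same cells
  repeatedly; each step adds at most \<open>1 / k^2\<close>.\<close>

lemma flow_along_path:
  assumes "(v, w) \<in> (step u) ^^ n"
  shows "\<exists>\<theta>. flow_on {..<N} adj (\<lambda>i. spread v i - spread w i) \<theta> \<and> (\<forall>i j. \<bar>\<theta> i j\<bar> \<le> n / k^2) \<and>
     (\<forall>i j. \<theta> i j \<noteq> 0 \<longrightarrow> i \<in> window_reps u \<and> j \<in> window_reps u)"
  using assms
proof (induction n arbitrary: w)
  case 0
  have "flow_on {..<N} adj (\<lambda>i. spread v i - spread w i) (\<lambda>_ _. 0)"
    by (rule flow_on_cong[OF flow_on_zero]) (use 0 in auto)
  then show ?case by (intro exI[of _ "\<lambda>_ _. 0"]) auto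
next
  case (Suc n)
  then obtain x where x: "(v, x) \<in> (step u) ^^ n" "(x, w) \<in> step u" by auto
  obtain \<theta> where \<theta>: "flow_on {..<N} adj (\<lambda>i. spread v i - spread x i) \<theta>" "\<And>i j. \<bar>\<theta> i j\<bar> \<le> n / k^2"
     "\<And>i j. \<theta> i j \<noteq> 0 \<Longrightarrow> i \<in> window_reps u \<and> j \<in> window_reps u"
    using Suc.IH[OF x(1)] by blast
  have g: "good x" "good w" "x \<in> window m K u" "w \<in> window m K u" "cell_near R x w"
    using x(2) by (auto simp: step_def)
  obtain \<theta>' where \<theta>': "flow_on {..<N} adj (\<lambda>i. spread x i - spread w i) \<theta>'" "\<And>i j. \<bar>\<theta>' i j\<bar> \<le> 1 / k^2"
     "\<And>i j. \<theta>' i j \<noteq> 0 \<Longrightarrow> i \<in> reps x \<union> reps w \<and> j \<in> reps x \<union> reps w"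
    using flow_between_cells[OF g(1,2,5)] by blast
  have sub: "reps x \<union> reps w \<subseteq> window_reps u"
    using g unfolding window_reps_def by blast
  let ?\<theta> = "\<lambda>i j. \<theta> i j + \<theta>' i j"
  have "flow_on {..<N} adj (\<lambda>i. spread v i - spread w i) ?\<theta>"
    by (rule flow_on_cong[OF flow_on_add[OF \<theta>(1) \<theta>'(1)]]) simp
  moreover have "\<bar>?\<theta> i j\<bar> \<le> real (Suc n) / k^2" for i j
  proof -
    have "\<bar>?\<theta> i j\<bar> \<le> n / k^2 + 1 / k^2"
      using \<theta>(2)[of i j] \<theta>'(2)[of i j] abs_triangle_ineq[of "\<theta> i j" "\<theta>' i j"] by linarith
    then show ?thesis by (simp add: add_divide_distrib)
  qed
  moreover have "i \<in> window_reps u \<and> j \<in> window_reps u" if "?\<theta> i j \<noteq> 0" for i j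
  proof (cases "\<theta> i j = 0")
    case True
    with that have "\<theta>' i j \<noteq> 0" by simp
    then show ?thesis using \<theta>'(3) sub by blast
  qed (use \<theta>(3) in blast)
  ultimately show ?case by (intro exI[of _ ?\<theta>]) blast
qed

lemma K_pos: "K \<ge> 7"
  using K_ge R3 by simp

lemma card_window_le_W:
  assumes "L \<le> K + 1"
  shows "card (window m L u) \<le> W"
proof -
  have "card (window m L u) \<le> card (window m (K + 1) u)"
    using assms by (intro card_mono) (auto simp: window_def)
  also have "\<dots> \<le> nat ((2 * (K + 1) + 1)^2)"
    using K_pos by (intro card_window_le) simp
  finally show ?thesis by (simp add: W_def algebra_simps)
qed

lemma card_window_reps_le: "card (window_reps u) \<le> W * k"
proof -
  have "card (window_reps u) \<le> (\<Sum>a\<in>{a \<in> window m K u. good a}. card (reps a))"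
    unfolding window_reps_def by (rule card_UN_le) simp
  also have "\<dots> = card {a \<in> window m K u. good a} * k" using reps(2) by simp
  also have "\<dots> \<le> card (window m K u) * k" by (intro mult_right_mono card_mono) auto
  also have "\<dots> \<le> W * k" by (intro mult_right_mono card_window_le_W) auto
  finally show ?thesis .
qed

lemma finite_window_reps: "finite (window_reps u)"
  unfolding window_reps_def using finite_reps by auto

lemma cell_window_reps: "i \<in> window_reps u \<Longrightarrow> cell i \<in> window m K u"
  unfolding window_reps_def using reps(1) by fastforce

lemma card_step_le: "card (step u) \<le> W^2"
proof -
  have "card (step u) \<le> card (window m K u \<times> window m K u)"
    by (intro card_mono) (auto simp: step_def)
  also have "\<dots> \<le> W * W"
    unfolding card_cartesian_product by (intro mult_mono card_window_le_W) auto
  finally show ?thesis by (simp add: power2_eq_square)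
qed

lemma finite_step: "finite (step u)"
  by (rule finite_subset[of _ "window m K u \<times> window m K u"]) (auto simp: step_def)

text \<open>A stand-in for every cell of the grid, good or bad, and always different from the cell
  itself.\<close>

definition rep_cell :: "int \<times> int \<Rightarrow> int \<times> int" where
  "rep_cell u = (SOME w. w \<in> cells m \<and> w \<noteq> u \<and> good w \<and> cell_near R u w)"

lemma rep_cell:
  assumes "u \<in> cells m"
  shows "rep_cell u \<in> cells m" "rep_cell u \<noteq> u" "good (rep_cell u)" "cell_near R u (rep_cell u)"
proof -
  have "\<exists>w. w \<in> cells m \<and> w \<noteq> u \<and> good w \<and> cell_near R u w"
    using ex_good_neighbour[OF assms] by blast
  from someI_ex[OF this] show "rep_cell u \<in> cells m" "rep_cell u \<noteq> u" "good (rep_cell u)" "cell_near R u (rep_cell u)"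
    unfolding rep_cell_def by auto
qed

text \<open>A walk in a finite relation can be shortened to at most as many steps as the relation
  has pairs, here \<open>W^2\<close>. At most \<open>(W * k)^2\<close> ordered pairs of points carry
  current, each at most \<open>W^2 / k^2\<close>, so the energy is at most
  \<open>W^6 / k^2\<close>.\<close>

lemma local_flow:
  assumes u: "u \<in> cells m" and u': "u' \<in> cells m" and adj: "grid_adj u u'"
  shows "\<exists>\<theta>. flow_on {..<N} adj (\<lambda>i. spread (rep_cell u) i - spread (rep_cell u') i) \<theta> \<and>
     energy_on {..<N} \<theta> \<le> real W^6 / k^2 \<and>
     (\<forall>i j. \<theta> i j \<noteq> 0 \<longrightarrow> i \<in> window_reps u \<and> j \<in> window_reps u)"
proof -
  have R0: "R > 0" using R3 by simp
  have w: "rep_cell u \<in> window m (R + 1) u"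
    using cell_near_less[OF rep_cell(4)[OF u] R0] rep_cell(1)[OF u] by (auto simp: window_def)
  have w': "rep_cell u' \<in> window m (R + 1) u"
    using cell_near_less[OF rep_cell(4)[OF u'] R0] rep_cell(1)[OF u'] adj
    unfolding window_def grid_adj_def mem_Collect_eq by linarith
  obtain c where c: "\<And>v. v \<in> window m (R + 1) u \<Longrightarrow> good v \<Longrightarrow> (v, c) \<in> (step u)\<^sup>*"
    using good_cells_connected[OF u] by blast
  have "(rep_cell u, rep_cell u') \<in> (step u)\<^sup>*"
    by (rule rtrancl_trans[OF c[OF w] step_rtrancl_sym[OF c[OF w']]]) (rule rep_cell u u')+
  then obtain n where n: "n \<le> card (step u)" "(rep_cell u, rep_cell u') \<in> (step u) ^^ n"
    unfolding rtrancl_finite_eq_relpow[OF finite_step] by blast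
  have nW: "n \<le> W^2" using n(1) card_step_le[of u] by linarith
  obtain \<theta> where \<theta>: "flow_on {..<N} adj (\<lambda>i. spread (rep_cell u) i - spread (rep_cell u') i) \<theta>"
      "\<And>i j. \<bar>\<theta> i j\<bar> \<le> n / k^2" "\<And>i j. \<theta> i j \<noteq> 0 \<Longrightarrow> i \<in> window_reps u \<and> j \<in> window_reps u"
    using flow_along_path[OF n(2)] by blast
  have sq: "(\<theta> i j)^2 \<le> of_bool (i \<in> window_reps u) * of_bool (j \<in> window_reps u) * (W^2 / k^2)^2" for i j
  proof (cases "\<theta> i j = 0")
    case False
    have "real n \<le> real W ^ 2" using nW by (metis of_nat_le_iff of_nat_power)
    then have "\<bar>\<theta> i j\<bar> \<le> W^2 / k^2"
      by (intro order_trans[OF \<theta>(2)] divide_right_mono) auto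
    then have "\<bar>\<theta> i j\<bar>^2 \<le> (W^2 / k^2)^2" by (intro power_mono) auto
    then show ?thesis using \<theta>(3)[OF False] by simp
  qed simp
  have cnt: "(\<Sum>i<N. of_bool (i \<in> window_reps u)) \<le> real W * k"
  proof -
    have "(\<Sum>i<N. of_bool (i \<in> window_reps u) :: real) = card ({..<N} \<inter> window_reps u)"
      by (simp add: of_bool_def sum.If_cases Collect_mem_eq)
    also have "\<dots> \<le> card (window_reps u)"
      by (intro of_nat_mono card_mono finite_window_reps) auto
    also have "\<dots> \<le> real (W * k)" by (intro of_nat_mono card_window_reps_le)
    finally show ?thesis by simp
  qed
  have "energy_on {..<N} \<theta> \<le> (\<Sum>i<N. \<Sum>j<N. of_bool (i \<in> window_reps u) * of_bool (j \<in> window_reps u) * (W^2 / k^2)^2)"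
    unfolding energy_on_def by (intro sum_mono sq)
  also have "\<dots> = (\<Sum>i<N. of_bool (i \<in> window_reps u)) * (\<Sum>j<N. of_bool (j \<in> window_reps u)) * (W^2 / k^2)^2"
    unfolding sum_product by (simp only: sum_distrib_right)
  also have "\<dots> \<le> (real W * k) * (real W * k) * (W^2 / k^2)^2"
    by (intro mult_right_mono mult_mono cnt sum_nonneg) auto
  also have "\<dots> = real W^6 / k^2"
    using k_pos by (simp add: field_simps power2_eq_square power_def numeral_eq_Suc)
  finally show ?thesis using \<theta> by blast
qed

text \<open>Each grid edge is replaced by its local flow, weighted with the grid current. A point
  lies on the local flows of at most \<open>W^2\<close> ordered pairs of cells, so Cauchy-Schwarz
  costs a factor \<open>W^2\<close> on top of the energy \<open>W^6 / k^2\<close> of a local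
  flow.\<close>

lemma transferred_flow:
  assumes a: "a \<in> cells m" and b: "b \<in> cells m" and res: "grid_res_le m a b e"
  shows "\<exists>\<theta>. flow_on {..<N} adj (\<lambda>i. spread (rep_cell a) i - spread (rep_cell b) i) \<theta> \<and>
     energy_on {..<N} \<theta> \<le> real W^8 / k^2 * e"
proof -
  obtain \<psi> where \<psi>: "flow_on (cells m) grid_adj (\<lambda>v. point_mass a v - point_mass b v) \<psi>" "energy_on (cells m) \<psi> \<le> e"
    using res unfolding grid_res_le_def by blast
  have \<psi>0: "\<psi> u v = 0" if "\<not> (u \<in> cells m \<and> v \<in> cells m \<and> grid_adj u v)" for u v
    using flow_on_support[OF \<psi>(1) that] .
  \<comment> \<open>\<open>P\<close> is unspecified off the grid edges, where \<open>\<psi>\<close>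
    vanishes.\<close>
  define P where "P = (\<lambda>u u'. SOME \<theta>. flow_on {..<N} adj (\<lambda>i. spread (rep_cell u) i - spread (rep_cell u') i) \<theta> \<and>
     energy_on {..<N} \<theta> \<le> real W^6 / k^2 \<and>
     (\<forall>i j. \<theta> i j \<noteq> 0 \<longrightarrow> i \<in> window_reps u \<and> j \<in> window_reps u))"
  have P: "flow_on {..<N} adj (\<lambda>i. spread (rep_cell u) i - spread (rep_cell u') i) (P u u') \<and>
     energy_on {..<N} (P u u') \<le> real W^6 / k^2 \<and>
     (\<forall>i j. P u u' i j \<noteq> 0 \<longrightarrow> i \<in> window_reps u \<and> j \<in> window_reps u)"
    if "u \<in> cells m" "u' \<in> cells m" "grid_adj u u'" for u u'
    unfolding P_def by (rule someI_ex[OF local_flow[OF that]])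
  define I where "I = cells m \<times> cells m"
  define X where "X = (\<lambda>e i j. \<psi> (fst e) (snd e) * P (fst e) (snd e) i j)"
  \<comment> \<open>Ordered pairs make every grid edge contribute twice; the factor
    \<open>1 / 2\<close> restores the divergence.\<close>
  define \<theta> where "\<theta> = (\<lambda>i j. 1 / 2 * (\<Sum>e\<in>I. X e i j))"
  let ?s = "\<lambda>u i. spread (rep_cell u) i"
  have fI: "finite I" by (simp add: I_def)
  have "flow_on {..<N} adj (\<lambda>i. \<psi> (fst e) (snd e) * (?s (fst e) i - ?s (snd e) i)) (X e)" if "e \<in> I" for e
  proof (cases "grid_adj (fst e) (snd e)")
    case True
    have "flow_on {..<N} adj (\<lambda>i. ?s (fst e) i - ?s (snd e) i) (P (fst e) (snd e))"
      using P[of "fst e" "snd e"] True that by (auto simp: I_def)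
    from flow_on_scale[OF this] show ?thesis unfolding X_def .
  next
    case False
    then have "\<psi> (fst e) (snd e) = 0" using \<psi>0 by blast
    then show ?thesis unfolding X_def by (simp add: flow_on_zero)
  qed
  note F = flow_on_scale[OF flow_on_sum[OF fI this], where c = "1/2"]
  have flow: "flow_on {..<N} adj (\<lambda>i. ?s a i - ?s b i) \<theta>"
    unfolding \<theta>_def
  proof (rule flow_on_cong[OF F])
    fix i
    have 1: "(\<Sum>u\<in>cells m. \<Sum>v\<in>cells m. \<psi> u v * ?s u i) = ?s a i - ?s b i"
    proof -
      have "(\<Sum>u\<in>cells m. \<Sum>v\<in>cells m. \<psi> u v * ?s u i) = (\<Sum>u\<in>cells m. (point_mass a u - point_mass b u) * ?s u i)"
        by (intro sum.cong refl) (simp only: sum_distrib_right[symmetric] flow_on_div[OF \<psi>(1)])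
      also have "\<dots> = (\<Sum>u\<in>cells m. if u = a then ?s u i else 0) - (\<Sum>u\<in>cells m. if u = b then ?s u i else 0)"
        unfolding sum_subtractf[symmetric] by (intro sum.cong refl) (auto simp: point_mass_def)
      also have "\<dots> = ?s a i - ?s b i" using a b by simp
      finally show ?thesis .
    qed
    have 2: "(\<Sum>u\<in>cells m. \<Sum>v\<in>cells m. \<psi> u v * ?s v i) = - (\<Sum>u\<in>cells m. \<Sum>v\<in>cells m. \<psi> u v * ?s u i)"
    proof -
      have "(\<Sum>u\<in>cells m. \<Sum>v\<in>cells m. \<psi> u v * ?s v i) = (\<Sum>v\<in>cells m. \<Sum>u\<in>cells m. \<psi> u v * ?s v i)"
        by (rule sum.swap)
      also have "\<dots> = (\<Sum>v\<in>cells m. \<Sum>u\<in>cells m. - (\<psi> v u * ?s v i))"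
        by (intro sum.cong refl) (subst flow_on_antisym[OF \<psi>(1)], simp)
      finally show ?thesis by (simp add: sum_negf)
    qed
    have "(\<Sum>e\<in>I. \<psi> (fst e) (snd e) * (?s (fst e) i - ?s (snd e) i)) =
       (\<Sum>u\<in>cells m. \<Sum>v\<in>cells m. \<psi> u v * (?s u i - ?s v i))"
      unfolding I_def by (simp add: sum.cartesian_product case_prod_beta)
    also have "\<dots> = (\<Sum>u\<in>cells m. \<Sum>v\<in>cells m. \<psi> u v * ?s u i) - (\<Sum>u\<in>cells m. \<Sum>v\<in>cells m. \<psi> u v * ?s v i)"
      by (simp only: right_diff_distrib sum_subtractf)
    also have "\<dots> = 2 * (?s a i - ?s b i)" unfolding 2 1 by simp
    finally show "1 / 2 * (\<Sum>e\<in>I. \<psi> (fst e) (snd e) * (?s (fst e) i - ?s (snd e) i)) = ?s a i - ?s b i"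
      by simp
  qed
  have sq: "(\<theta> i j)^2 \<le> real W^2 * (\<Sum>e\<in>I. (X e i j)^2)" for i j
  proof -
    \<comment> \<open>Locality: a grid edge whose local flow passes through \<open>i\<close> starts
      within \<open>K\<close> of the cell of \<open>i\<close> and therefore ends within
      \<open>K + 1\<close> of it.\<close>
    define J where "J = window m K (cell i) \<times> window m (K + 1) (cell i)"
    have zero: "X e i j = 0" if "e \<in> I - J" for e
    proof (rule ccontr)
      assume nz: "X e i j \<noteq> 0"
      then have e: "fst e \<in> cells m" "snd e \<in> cells m" "grid_adj (fst e) (snd e)" "P (fst e) (snd e) i j \<noteq> 0"
        using \<psi>0[of "fst e" "snd e"] unfolding X_def by auto
      then have "i \<in> window_reps (fst e)" using P by blast
      then have "cell i \<in> window m K (fst e)" by (rule cell_window_reps)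
      then have "fst e \<in> window m K (cell i)" "snd e \<in> window m (K + 1) (cell i)"
        using e(1-3) unfolding window_def grid_adj_def mem_Collect_eq by linarith+
      then have "e \<in> J" by (simp add: J_def mem_Times_iff)
      with that show False by simp
    qed
    have "(\<Sum>e\<in>I. X e i j)^2 = (\<Sum>e\<in>I \<inter> J. X e i j)^2"
      using sum.mono_neutral_right[OF fI, of "I \<inter> J" "\<lambda>e. X e i j"] zero by auto
    also have "\<dots> \<le> (\<Sum>e\<in>I \<inter> J. (X e i j)^2) * card (I \<inter> J)"
      by (rule sum_squared_le_sum_of_squares)
    also have "\<dots> \<le> (\<Sum>e\<in>I. (X e i j)^2) * (real W)^2"
    proof (intro mult_mono)
      show "(\<Sum>e\<in>I \<inter> J. (X e i j)^2) \<le> (\<Sum>e\<in>I. (X e i j)^2)"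
        by (intro sum_mono2 fI) auto
      have "card (I \<inter> J) \<le> card J" by (intro card_mono) (auto simp: J_def)
      also have "\<dots> \<le> W * W"
        unfolding J_def card_cartesian_product by (intro mult_mono card_window_le_W) auto
      finally show "real (card (I \<inter> J)) \<le> (real W)^2"
        by (metis of_nat_le_iff of_nat_mult power2_eq_square)
    qed (auto intro: sum_nonneg)
    finally have "(\<Sum>e\<in>I. X e i j)^2 \<le> (real W)^2 * (\<Sum>e\<in>I. (X e i j)^2)" by (simp add: mult.commute)
    moreover have "(\<theta> i j)^2 = (\<Sum>e\<in>I. X e i j)^2 / 4"
      unfolding \<theta>_def by (simp add: power2_eq_square)
    ultimately show ?thesis using zero_le_power2[of "\<Sum>e\<in>I. X e i j"] by linarith
  qed
  have "(\<Sum>i<N. \<Sum>j<N. \<Sum>e\<in>I. (X e i j)^2) = (\<Sum>i<N. \<Sum>e\<in>I. \<Sum>j<N. (X e i j)^2)"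
    by (rule sum.cong[OF refl], rule sum.swap)
  also have "\<dots> = (\<Sum>e\<in>I. \<Sum>i<N. \<Sum>j<N. (X e i j)^2)"
    by (rule sum.swap)
  also have "\<dots> = (\<Sum>e\<in>I. (\<psi> (fst e) (snd e))^2 * energy_on {..<N} (P (fst e) (snd e)))"
    unfolding X_def energy_on_def power_mult_distrib by (simp only: sum_distrib_left)
  also have "\<dots> \<le> (\<Sum>e\<in>I. (\<psi> (fst e) (snd e))^2 * (real W^6 / k^2))"
  proof (intro sum_mono)
    fix e assume "e \<in> I"
    show "(\<psi> (fst e) (snd e))^2 * energy_on {..<N} (P (fst e) (snd e)) \<le> (\<psi> (fst e) (snd e))^2 * (real W^6 / k^2)"
    proof (cases "\<psi> (fst e) (snd e) = 0")
      case False
      then have "energy_on {..<N} (P (fst e) (snd e)) \<le> real W^6 / k^2" using \<psi>0 P by blast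
      then show ?thesis by (intro mult_left_mono) auto
    qed simp
  qed
  also have "\<dots> = (\<Sum>e\<in>I. (\<psi> (fst e) (snd e))^2) * (real W^6 / k^2)"
    by (simp only: sum_distrib_right)
  also have "(\<Sum>e\<in>I. (\<psi> (fst e) (snd e))^2) = energy_on (cells m) \<psi>"
    unfolding energy_on_def I_def by (simp add: sum.cartesian_product case_prod_beta)
  also have "energy_on (cells m) \<psi> * (real W^6 / k^2) \<le> e * (real W^6 / k^2)"
    using \<psi>(2) by (intro mult_right_mono) auto
  finally have X_le: "(\<Sum>i<N. \<Sum>j<N. \<Sum>e\<in>I. (X e i j)^2) \<le> e * (real W^6 / k^2)" .
  have "energy_on {..<N} \<theta> \<le> (\<Sum>i<N. \<Sum>j<N. real W^2 * (\<Sum>e\<in>I. (X e i j)^2))"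
    unfolding energy_on_def by (intro sum_mono sq)
  also have "\<dots> = real W^2 * (\<Sum>i<N. \<Sum>j<N. \<Sum>e\<in>I. (X e i j)^2)"
    by (simp only: sum_distrib_left)
  also have "\<dots> \<le> real W^2 * (e * (real W^6 / k^2))"
    by (intro mult_left_mono X_le) auto
  also have "\<dots> = real W^8 / k^2 * e" by (simp add: power_add[of _ 2 6, simplified])
  finally have "energy_on {..<N} \<theta> \<le> real W^8 / k^2 * e" .
  with flow show ?thesis by blast
qed

text \<open>Current \<open>1 / k\<close> runs from \<open>x\<close> to each selected point of the
  stand-in cell. This cell is not the cell of \<open>x\<close>, so \<open>x\<close> is not among
  these points; \<open>2k\<close> ordered pairs with square \<open>1 / k^2\<close> give
  \<open>2 / k\<close>.\<close>

lemma star_flow: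
  assumes x: "x < N"
  shows "\<exists>\<theta>. flow_on {..<N} adj (\<lambda>i. point_mass x i - spread (rep_cell (cell x)) i) \<theta> \<and> energy_on {..<N} \<theta> \<le> 2 / k"
proof -
  let ?T = "reps (rep_cell (cell x))"
  note rc = rep_cell[OF cell_in[OF x]]
  have T: "?T \<subseteq> {i. i < N \<and> cell i = rep_cell (cell x)}" by (rule reps(1)[OF rc(3)])
  have xT: "x \<notin> ?T" using T rc(2) by auto
  define \<theta> where "\<theta> i j = (point_mass x i * of_bool (j \<in> ?T) - of_bool (i \<in> ?T) * point_mass x j) / real k" for i j
  have "flow_on {..<N} adj (\<lambda>i. point_mass x i - spread (rep_cell (cell x)) i) \<theta>"
    unfolding flow_on_def
  proof (intro conjI allI impI ballI)
    show "\<theta> i j = - \<theta> j i" for i j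
      unfolding \<theta>_def by (simp only: minus_divide_left minus_diff_eq mult.commute)
    show "\<theta> i j = 0" if "\<not> (i \<in> {..<N} \<and> j \<in> {..<N} \<and> adj i j)" for i j
    proof (rule ccontr)
      assume nz: "\<theta> i j \<noteq> 0"
      then have "i = x \<and> j \<in> ?T \<or> i \<in> ?T \<and> j = x"
        unfolding \<theta>_def point_mass_def by (auto split: if_splits)
      then have "i < N" "j < N" "i \<noteq> j" "cell_near R (cell i) (cell j)"
        using T x xT rc(4) cell_near_sym[of R "cell x" "rep_cell (cell x)"] by auto
      with adjI that show False by blast
    qed
    show "(\<Sum>j<N. \<theta> i j) = point_mass x i - spread (rep_cell (cell x)) i" for i
      unfolding \<theta>_def spread_def sum_divide_distrib[symmetric] sum_subtractf sum_distrib_left[symmetric]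
        sum_reps[OF rc(3)]
      using k_pos x by (simp add: sum_point_mass field_simps)
  qed
  moreover have "energy_on {..<N} \<theta> \<le> 2 / k"
  proof -
    have "(\<theta> i j)^2 \<le> (point_mass x i * of_bool (j \<in> ?T) + of_bool (i \<in> ?T) * point_mass x j) * (1 / (real k)^2)" for i j
      unfolding \<theta>_def power_divide using xT by (auto simp: point_mass_def)
    then have "energy_on {..<N} \<theta> \<le> (\<Sum>i<N. \<Sum>j<N. (point_mass x i * of_bool (j \<in> ?T) + of_bool (i \<in> ?T) * point_mass x j) * (1 / (real k)^2))"
      unfolding energy_on_def by (intro sum_mono)
    also have "\<dots> = ((\<Sum>i<N. point_mass x i) * (\<Sum>j<N. of_bool (j \<in> ?T)) + (\<Sum>i<N. of_bool (i \<in> ?T)) * (\<Sum>j<N. point_mass x j)) * (1 / (real k)^2)"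
      by (simp only: sum_distrib_right[symmetric] sum.distrib sum_product[symmetric])
    also have "\<dots> = 2 / k"
      using k_pos x unfolding sum_reps[OF rc(3)] by (simp add: sum_point_mass field_simps power2_eq_square)
    finally show ?thesis .
  qed
  ultimately show ?thesis by blast
qed

text \<open>Three flows are joined: from \<open>x\<close> to selected points near it, from these to
  selected points near \<open>y\<close>, and from there to \<open>y\<close>. Using
  \<open>energy_on_add_le\<close> twice gives \<open>2 * (2 / k) + 4 * (2 / k)\<close> for the ends
  and the coefficient \<open>4 * 132\<close> in the middle; halving leaves 6 and 264.\<close>

theorem effective_resistance_bound:
  assumes x: "x < N" and y: "y < N"
  shows "\<exists>\<theta>. unit_flow N adj x y \<theta> \<and> flow_energy N \<theta> \<le> 6 / k + (2 * real_of_int K + 3)^16 / k^2 * (264 * (1 + ln (real_of_int m)))"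
proof -
  let ?s = "\<lambda>x. spread (rep_cell (cell x))"
  let ?e = "132 * (1 + ln (real_of_int m))"
  have "m \<ge> 2" using m_ge K_pos by simp
  then have "grid_res_le m (cell x) (cell y) ?e"
    by (intro grid_res_le_ln cell_in x y)
  from transferred_flow[OF cell_in[OF x] cell_in[OF y] this]
  obtain \<theta> where \<theta>: "flow_on {..<N} adj (\<lambda>i. ?s x i - ?s y i) \<theta>" "energy_on {..<N} \<theta> \<le> real W^8 / k^2 * ?e"
    by blast
  obtain \<alpha> where \<alpha>: "flow_on {..<N} adj (\<lambda>i. point_mass x i - ?s x i) \<alpha>" "energy_on {..<N} \<alpha> \<le> 2 / k"
    using star_flow[OF x] by blast
  obtain \<beta> where \<beta>: "flow_on {..<N} adj (\<lambda>i. point_mass y i - ?s y i) \<beta>" "energy_on {..<N} \<beta> \<le> 2 / k"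
    using star_flow[OF y] by blast
  let ?\<gamma> = "\<lambda>i j. \<theta> i j + (-1) * \<beta> i j"
  let ?\<theta> = "\<lambda>i j. \<alpha> i j + ?\<gamma> i j"
  have "flow_on {..<N} adj (\<lambda>i. point_mass x i - point_mass y i) ?\<theta>"
    by (rule flow_on_cong[OF flow_on_add[OF \<alpha>(1) flow_on_add[OF \<theta>(1) flow_on_scale[OF \<beta>(1)]]]]) simp
  moreover have "energy_on {..<N} ?\<theta> \<le> 2 * (6 / k + real W^8 / k^2 * (264 * (1 + ln (real_of_int m))))"
  proof -
    have eq: "2 * (6 / k + real W^8 / k^2 * (264 * (1 + ln (real_of_int m)))) = 12 / k + 4 * (real W^8 / k^2 * ?e)"
      by (simp add: algebra_simps)
    show ?thesis
      unfolding eq using energy_on_add_le[of "{..<N}" \<alpha> ?\<gamma>] energy_on_add_le[of "{..<N}" \<theta> "\<lambda>i j. (-1) * \<beta> i j"]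
      energy_on_scale[of "{..<N}" "-1" \<beta>] \<theta>(2) \<alpha>(2) \<beta>(2) by (simp only: power2_minus one_power2 mult_1)
  qed
  moreover have "real W^8 = (2 * real_of_int K + 3)^16"
  proof -
    have "real W = (2 * real_of_int K + 3)^2" by (simp add: W_def)
    then show ?thesis by (simp flip: power_mult)
  qed
  ultimately have "flow_on {..<N} adj (\<lambda>i. point_mass x i - point_mass y i) ?\<theta> \<and>
      energy_on {..<N} ?\<theta> / 2 \<le> 6 / k + (2 * real_of_int K + 3)^16 / k^2 * (264 * (1 + ln (real_of_int m)))"
    by (simp only: simp_thms) (simp only: pos_divide_le_eq zero_less_numeral mult.commute[of _ 2])
  then show ?thesis
    unfolding unit_flow_iff flow_energy_eq by blast
qed

end

section \<open>Cells of the box\<close>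

lemma norm_real2: "norm (z :: real^2) = sqrt ((z$1)^2 + (z$2)^2)"
  unfolding norm_vec_def L2_set_def sum_2 by simp

lemma content_cbox_real2:
  fixes a b :: "real^2"
  assumes "a$1 \<le> b$1" "a$2 \<le> b$2"
  shows "measure lborel (cbox a b) = (b$1 - a$1) * (b$2 - a$2)"
proof -
  have "cbox a b \<noteq> {}" using assms unfolding interval_ne_empty_cart forall_2 by simp
  then show ?thesis by (simp add: content_cbox_cart UNIV_2)
qed

text \<open>One half of Gauss's circle argument: unit squares attached to the lattice points cover a
  slightly smaller ball, and areas are compared. The loss 3 in the radius absorbs rounding and the
  shift by 1 in \<open>cell_near\<close>.\<close>

lemma lattice_disc_card:
  assumes R: "R \<ge> 3"
  shows "pi * (real_of_int R - 3)^2 \<le> card {u. cell_near R (0, 0) u}"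
proof -
  define D where "D = {u. cell_near R (0, 0) u}"
  have "D \<subseteq> {-R..R} \<times> {-R..R}"
  proof
    fix x assume "x \<in> D"
    then have "cell_near R (0, 0) x" by (simp add: D_def)
    moreover have "R > 0" using R by simp
    ultimately show "x \<in> {-R..R} \<times> {-R..R}"
      using cell_near_less[of R "(0, 0)" x] unfolding mem_Times_iff atLeastAtMost_iff by auto
  qed
  then have fin: "finite D" by (rule finite_subset) simp
  define Q :: "int \<times> int \<Rightarrow> (real^2) set" where
    "Q u = cbox (vector [of_int (fst u), of_int (snd u)]) (vector [of_int (fst u) + 1, of_int (snd u) + 1])" for u
  have Q: "measure lborel (Q u) = 1" for u
    unfolding Q_def by (subst content_cbox_real2) (auto simp: vector_2)
  have sub: "ball 0 (real_of_int R - 3) \<subseteq> (\<Union>u\<in>D. Q u)"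
  proof
    fix z :: "real^2" assume z: "z \<in> ball 0 (real_of_int R - 3)"
    define \<rho> where "\<rho> = real_of_int R - 3"
    have \<rho>: "\<rho> \<ge> 0" using R by (simp add: \<rho>_def)
    have "norm z \<le> \<rho>" using z by (simp add: \<rho>_def)
    then have "(norm z)^2 \<le> \<rho>^2" by (intro power_mono) auto
    then have n: "\<bar>z$1\<bar>^2 + \<bar>z$2\<bar>^2 \<le> \<rho>^2" by (simp add: norm_real2)
    \<comment> \<open>Using \<open>3 / 2\<close> for the square root of 2 completes the square
      below: \<open>\<rho>^2 + 6 * \<rho> + 9 = (\<rho> + 3)^2\<close>.\<close>
    have "(\<bar>z$1\<bar> + \<bar>z$2\<bar>)^2 \<le> (3 / 2 * \<rho>)^2"
    proof -
      have "(\<bar>z$1\<bar> + \<bar>z$2\<bar>)^2 = \<bar>z$1\<bar>^2 + \<bar>z$2\<bar>^2 + 2 * \<bar>z$1\<bar> * \<bar>z$2\<bar>" by (rule power2_sum)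
      moreover have "(3 / 2 * \<rho>)^2 = 9 / 4 * \<rho>^2" by (simp add: power_mult_distrib power_divide)
      ultimately show ?thesis
        using n sum_squares_bound[of "\<bar>z$1\<bar>" "\<bar>z$2\<bar>"] zero_le_power2[of \<rho>] by linarith
    qed
    then have s: "\<bar>z$1\<bar> + \<bar>z$2\<bar> \<le> 3 / 2 * \<rho>" by (rule power2_le_imp_le) (use \<rho> in simp)
    define u where "u = (\<lfloor>z$1\<rfloor>, \<lfloor>z$2\<rfloor>)"
    have "real_of_int (\<bar>\<lfloor>z$1\<rfloor>\<bar> + 1) \<le> \<bar>z$1\<bar> + 2" "real_of_int (\<bar>\<lfloor>z$2\<rfloor>\<bar> + 1) \<le> \<bar>z$2\<bar> + 2" by linarith+
    then have "(real_of_int (\<bar>\<lfloor>z$1\<rfloor>\<bar> + 1))^2 + (real_of_int (\<bar>\<lfloor>z$2\<rfloor>\<bar> + 1))^2 \<le> (\<bar>z$1\<bar> + 2)^2 + (\<bar>z$2\<bar> + 2)^2"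
      by (intro add_mono power_mono) auto
    also have "\<dots> = (\<bar>z$1\<bar>^2 + \<bar>z$2\<bar>^2) + 4 * (\<bar>z$1\<bar> + \<bar>z$2\<bar>) + 8" by (simp add: power2_sum)
    also have "\<dots> \<le> \<rho>^2 + 4 * (3 / 2 * \<rho>) + 9" by (intro add_mono mult_left_mono n s) auto
    also have "\<dots> = (real_of_int R)^2" by (simp add: \<rho>_def power2_eq_square field_simps)
    finally have "real_of_int ((\<bar>\<lfloor>z$1\<rfloor>\<bar> + 1)^2 + (\<bar>\<lfloor>z$2\<rfloor>\<bar> + 1)^2) \<le> real_of_int (R^2)" by simp
    then have "(\<bar>\<lfloor>z$1\<rfloor>\<bar> + 1)^2 + (\<bar>\<lfloor>z$2\<rfloor>\<bar> + 1)^2 \<le> R^2" by (simp only: of_int_le_iff)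
    then have "u \<in> D" by (simp add: D_def u_def cell_near_def)
    moreover have "z \<in> Q u"
      unfolding Q_def u_def mem_box_cart forall_2 vector_2 fst_conv snd_conv by linarith
    ultimately show "z \<in> (\<Union>u\<in>D. Q u)" by blast
  qed
  have "pi * (real_of_int R - 3)^2 = measure lborel (ball (0 :: real^2) (real_of_int R - 3))"
    using R content_ball[of "real_of_int R - 3" "0 :: real^2"] by (simp add: unit_ball_vol_2 measure_completion)
  also have "\<dots> \<le> measure lborel (\<Union>u\<in>D. Q u)"
    using sub fin
    by (intro measure_mono_fmeasurable fmeasurable.finite_UN) (auto simp: Q_def fmeasurable_cbox)
  also have "\<dots> \<le> (\<Sum>u\<in>D. measure lborel (Q u))"
    using fin by (intro measure_UNION_le) (auto simp: Q_def)
  also have "\<dots> = card D" by (simp add: Q)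
  finally show ?thesis unfolding D_def .
qed

text \<open>The disc consists of the half disc, its mirror image and a middle row of at most
  \<open>2 * R + 1\<close> cells, a loss of lower order than the area.\<close>

lemma card_half_disc_ge:
  assumes R: "R \<ge> 3"
  shows "pi * (real_of_int R - 3)^2 - 2 * real_of_int R - 1 \<le> 2 * real (card (half_disc R))"
proof -
  have R0: "R > 0" using R by simp
  let ?H = "half_disc R" and ?Z = "{-R..R} \<times> {0 :: int}"
  let ?n = "\<lambda>x :: int \<times> int. (fst x, - snd x)"
  have "{u. cell_near R (0, 0) u} \<subseteq> ?H \<union> ?n ` ?H \<union> ?Z"
  proof
    fix u assume "u \<in> {u. cell_near R (0, 0) u}"
    then have u: "cell_near R (0, 0) u" by simp
    then have u': "cell_near R (0, 0) (?n u)" by (simp add: cell_near_def)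
    consider "snd u \<ge> 1" | "snd u = 0" | "snd u \<le> -1" by linarith
    then show "u \<in> ?H \<union> ?n ` ?H \<union> ?Z"
    proof cases
      case 1
      then show ?thesis using u by (simp add: half_disc_def)
    next
      case 2
      then show ?thesis using cell_near_less(1)[OF u R0] by (auto simp: mem_Times_iff)
    next
      case 3
      then have "?n u \<in> ?H" using u' by (simp add: half_disc_def)
      then have "?n (?n u) \<in> ?n ` ?H" by (rule imageI)
      then show ?thesis by simp
    qed
  qed
  then have "card {u. cell_near R (0, 0) u} \<le> card (?H \<union> ?n ` ?H \<union> ?Z)"
    using half_disc_finite[OF R0] by (intro card_mono) auto
  also have "\<dots> \<le> card ?H + card (?n ` ?H) + card ?Z"
    by (meson add_mono card_Un_le order_refl order_trans)
  also have "\<dots> \<le> card ?H + card ?H + card ?Z"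
    by (intro add_mono card_image_le half_disc_finite R0) auto
  finally have "real (card {u. cell_near R (0, 0) u}) \<le> 2 * real (card ?H) + real (card ?Z)" by simp
  moreover have "real (card ?Z) = 2 * real_of_int R + 1" using R0 by (simp add: card_cartesian_product)
  ultimately show ?thesis using lattice_disc_card[OF R] by linarith
qed

section \<open>The cell of a point, and the probability of a cell\<close>

definition cell_index :: "nat \<Rightarrow> int \<Rightarrow> real \<Rightarrow> int" where
  "cell_index n m x = min (m - 1) \<lfloor>(x + sqrt (real n) / 2) * (of_int m / sqrt (real n))\<rfloor>"

definition cell_of :: "nat \<Rightarrow> int \<Rightarrow> real^2 \<Rightarrow> int \<times> int" where
  "cell_of n m p = (cell_index n m (p$1), cell_index n m (p$2))"

lemma mem_box_n: "p \<in> box_n n \<longleftrightarrow> \<bar>p$1\<bar> \<le> sqrt (real n) / 2 \<and> \<bar>p$2\<bar> \<le> sqrt (real n) / 2"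
  unfolding box_n_def by (auto simp: mem_box_cart forall_2)

lemma cell_index_bounds:
  assumes n: "n > 0" and m: "m > 0" and x: "\<bar>x\<bar> \<le> sqrt (real n) / 2"
  shows "0 \<le> cell_index n m x" "cell_index n m x < m"
    "of_int (cell_index n m x) * (sqrt (real n) / of_int m) \<le> x + sqrt (real n) / 2"
    "x + sqrt (real n) / 2 \<le> (of_int (cell_index n m x) + 1) * (sqrt (real n) / of_int m)"
proof -
  define L where "L = of_int m / sqrt (real n)"
  define y where "y = (x + sqrt (real n) / 2) * L"
  have L: "L > 0" using n m by (simp add: L_def)
  have inv: "sqrt (real n) / of_int m = 1 / L" using n by (simp add: L_def)
  have y0: "0 \<le> y" using x L unfolding y_def by (intro mult_nonneg_nonneg) auto
  have "y \<le> sqrt (real n) * L" unfolding y_def using x L by (intro mult_right_mono) auto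
  then have ym: "y \<le> of_int m" using n by (simp add: L_def)
  \<comment> \<open>The minimum in \<open>cell_index\<close> matters at the upper end of the
    interval, where \<open>y\<close> equals \<open>m\<close> and the floor alone would leave the
    grid.\<close>
  have ci: "cell_index n m x = min (m - 1) \<lfloor>y\<rfloor>" by (simp add: cell_index_def y_def L_def)
  show "0 \<le> cell_index n m x" "cell_index n m x < m" using y0 m by (auto simp: ci)
  have "of_int (cell_index n m x) \<le> y" "y \<le> of_int (cell_index n m x) + 1"
    using ym unfolding ci by (auto simp: min_def) linarith+
  then show "of_int (cell_index n m x) * (sqrt (real n) / of_int m) \<le> x + sqrt (real n) / 2"
    "x + sqrt (real n) / 2 \<le> (of_int (cell_index n m x) + 1) * (sqrt (real n) / of_int m)"
    unfolding inv using L by (auto simp: y_def field_simps)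
qed

lemma cell_of_mem: "n > 0 \<Longrightarrow> m > 0 \<Longrightarrow> p \<in> box_n n \<Longrightarrow> cell_of n m p \<in> cells m"
  using cell_index_bounds(1,2)[of n m] by (auto simp: mem_box_n cell_of_def mem_cells)

lemma dist_le_of_cell_near:
  assumes n: "n > 0" and m: "m > 0" and R: "R > 0" and p: "p \<in> box_n n" and q: "q \<in> box_n n"
    and near: "cell_near R (cell_of n m p) (cell_of n m q)"
    and r: "real_of_int R * (sqrt (real n) / of_int m) \<le> r"
  shows "dist p q \<le> r"
proof -
  define l where "l = sqrt (real n) / of_int m"
  have l: "l > 0" using n m by (simp add: l_def)
  have d: "\<bar>x - y\<bar> \<le> real_of_int (\<bar>cell_index n m x - cell_index n m y\<bar> + 1) * l"
    if x: "\<bar>x\<bar> \<le> sqrt (real n) / 2" and y: "\<bar>y\<bar> \<le> sqrt (real n) / 2" for x y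
  proof -
    define a b where "a = cell_index n m x" and "b = cell_index n m y"
    note cx = cell_index_bounds(3,4)[OF n m x, folded l_def a_def]
      and cy = cell_index_bounds(3,4)[OF n m y, folded l_def b_def]
    have "x - y \<le> (real_of_int (a - b) + 1) * l" "y - x \<le> (real_of_int (b - a) + 1) * l"
      using cx cy by (auto simp: algebra_simps)
    moreover have "(real_of_int (a - b) + 1) * l \<le> real_of_int (\<bar>a - b\<bar> + 1) * l"
      "(real_of_int (b - a) + 1) * l \<le> real_of_int (\<bar>a - b\<bar> + 1) * l"
      using l by (intro mult_right_mono; simp)+
    ultimately show ?thesis unfolding a_def b_def by linarith
  qed
  define A B where "A = \<bar>cell_index n m (p$1) - cell_index n m (q$1)\<bar> + 1"
    and "B = \<bar>cell_index n m (p$2) - cell_index n m (q$2)\<bar> + 1"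
  have AB: "A^2 + B^2 \<le> R^2" using near by (simp add: cell_near_def cell_of_def A_def B_def)
  have "(p$1 - q$1)^2 + (p$2 - q$2)^2 = \<bar>p$1 - q$1\<bar>^2 + \<bar>p$2 - q$2\<bar>^2" by simp
  also have "\<dots> \<le> (real_of_int A * l)^2 + (real_of_int B * l)^2"
    unfolding A_def B_def using p q by (intro add_mono power_mono d) (auto simp: mem_box_n)
  also have "\<dots> = real_of_int (A^2 + B^2) * l^2" by (simp add: power_mult_distrib algebra_simps)
  also have "\<dots> \<le> real_of_int (R^2) * l^2" using AB by (intro mult_right_mono) (auto simp only: of_int_le_iff zero_le_power2)
  also have "\<dots> = (real_of_int R * l)^2" by (simp add: power_mult_distrib)
  finally have "(p$1 - q$1)^2 + (p$2 - q$2)^2 \<le> (real_of_int R * l)^2" .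
  then have "dist p q \<le> real_of_int R * l"
    unfolding dist_norm norm_real2 using R l by (intro real_le_lsqrt) auto
  with r show ?thesis by (simp add: l_def)
qed

lemma cell_of_measurable: "{p. cell_of n m p = a} \<in> sets borel"
proof -
  have c: "{p :: real^2. cell_index n m (p$i) = b} \<in> sets borel" for i b
  proof -
    have "(\<lambda>p :: real^2. \<lfloor>(p$i + sqrt (real n) / 2) * (of_int m / sqrt (real n))\<rfloor>) \<in> borel \<rightarrow>\<^sub>M count_space UNIV"
      by measurable
    then have "(\<lambda>p :: real^2. cell_index n m (p$i)) \<in> borel \<rightarrow>\<^sub>M count_space UNIV"
      unfolding cell_index_def by (rule measurable_compose) simp
    from measurable_sets[OF this, of "{b}"] show ?thesis by (simp add: vimage_def)
  qed
  have "{p. cell_of n m p = a} = {p. cell_index n m (p$1) = fst a} \<inter> {p. cell_index n m (p$2) = snd a}"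
    by (auto simp: cell_of_def prod_eq_iff)
  then show ?thesis using c by auto
qed

lemma measure_box_n: "measure lborel (box_n n) = real n"
  unfolding box_n_def by (subst content_cbox_real2) (auto simp flip: power2_eq_square)

lemma emeasure_box_n: "emeasure lborel (box_n n) = ennreal (real n)"
proof -
  have "emeasure lborel (box_n n) \<noteq> \<infinity>"
    unfolding box_n_def using emeasure_lborel_cbox_finite by (metis less_irrefl)
  then show ?thesis using measure_box_n[of n] by (simp add: emeasure_eq_ennreal_measure)
qed

abbreviation "unif n \<equiv> uniform_measure lborel (box_n n)"

lemma prob_space_unif: "n > 0 \<Longrightarrow> prob_space (unif n)"
  by (rule prob_space_uniform_measure) (auto simp: emeasure_box_n)

lemma measure_unif: "A \<in> sets borel \<Longrightarrow> n > 0 \<Longrightarrow> measure (unif n) A = measure lborel (box_n n \<inter> A) / real n"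
  by (subst measure_uniform_measure) (auto simp: emeasure_box_n measure_box_n)

text \<open>The open square avoids the boundary conventions of \<open>cell_of\<close> and has the
  same area as the closed one. A lower bound is what the estimate for sparse cells asks for.\<close>

lemma unif_cell_ge:
  assumes n: "n > 0" and m: "m > 0" and a: "a \<in> cells m"
  shows "1 / (real_of_int m)^2 \<le> measure (unif n) {p. cell_of n m p = a}"
proof -
  define l where "l = sqrt (real n) / of_int m"
  have l: "l > 0" using n m by (simp add: l_def)
  have ml: "of_int m * l = sqrt (real n)" using m by (simp add: l_def)
  define lo hi :: "real^2" where
    "lo = vector [of_int (fst a) * l - sqrt (real n) / 2, of_int (snd a) * l - sqrt (real n) / 2]" and
    "hi = vector [(of_int (fst a) + 1) * l - sqrt (real n) / 2, (of_int (snd a) + 1) * l - sqrt (real n) / 2]"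
  have idx: "cell_index n m x = b \<and> \<bar>x\<bar> \<le> sqrt (real n) / 2"
    if b: "0 \<le> b" "b < m" and x: "of_int b * l - sqrt (real n) / 2 < x" "x < (of_int b + 1) * l - sqrt (real n) / 2" for b x
  proof
    have "(x + sqrt (real n) / 2) * (of_int m / sqrt (real n)) = (x + sqrt (real n) / 2) / l" by (simp add: l_def)
    moreover have "of_int b \<le> (x + sqrt (real n) / 2) / l" "(x + sqrt (real n) / 2) / l < of_int b + 1"
      using x l by (auto simp: field_simps)
    ultimately have "\<lfloor>(x + sqrt (real n) / 2) * (of_int m / sqrt (real n))\<rfloor> = b" by (simp add: floor_eq_iff)
    then show "cell_index n m x = b" using b by (simp add: cell_index_def)
    have "0 \<le> of_int b * l" using b l by simp
    moreover have "(of_int b + 1) * l \<le> of_int m * l" using b l by (intro mult_right_mono) auto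
    ultimately show "\<bar>x\<bar> \<le> sqrt (real n) / 2" using x ml by linarith
  qed
  have sub: "box lo hi \<subseteq> box_n n \<inter> {p. cell_of n m p = a}"
  proof
    fix p assume "p \<in> box lo hi"
    then have p: "of_int (fst a) * l - sqrt (real n) / 2 < p$1" "p$1 < (of_int (fst a) + 1) * l - sqrt (real n) / 2"
      "of_int (snd a) * l - sqrt (real n) / 2 < p$2" "p$2 < (of_int (snd a) + 1) * l - sqrt (real n) / 2"
      by (auto simp: mem_box_cart forall_2 lo_def hi_def vector_2)
    show "p \<in> box_n n \<inter> {p. cell_of n m p = a}"
      using idx[OF _ _ p(1,2)] idx[OF _ _ p(3,4)] a by (auto simp: mem_box_n cell_of_def mem_cells prod_eq_iff)
  qed
  have "l^2 = measure lborel (cbox lo hi)"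
    using l by (subst content_cbox_real2) (auto simp: lo_def hi_def vector_2 power2_eq_square algebra_simps)
  also have "\<dots> = measure lborel (box lo hi)"
    by (simp add: measure_lborel_cbox_eq measure_lborel_box_eq)
  also have "\<dots> \<le> measure lborel (box_n n \<inter> {p. cell_of n m p = a})"
    using sub cell_of_measurable[of n m a]
    by (intro measure_mono_fmeasurable) (auto simp: box_n_def intro!: fmeasurable_Int_fmeasurable fmeasurable_cbox)
  finally have "l^2 / n \<le> measure (unif n) {p. cell_of n m p = a}"
    using n by (simp add: measure_unif[OF cell_of_measurable] divide_right_mono)
  moreover have "l^2 / n = 1 / (real_of_int m)^2" using n by (simp add: l_def power_divide)
  ultimately show ?thesis by simp
qed

lemma unif_cells_ge:
  assumes n: "n > 0" and m: "m > 0" and A: "A \<subseteq> cells m"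
  shows "card A / (real_of_int m)^2 \<le> measure (unif n) {p. cell_of n m p \<in> A}"
proof -
  interpret prob_space "unif n" by (rule prob_space_unif[OF n])
  have fin: "finite A" by (rule finite_subset[OF A finite_cells])
  have "card A / (real_of_int m)^2 = (\<Sum>a\<in>A. 1 / (real_of_int m)^2)" by simp
  also have "\<dots> \<le> (\<Sum>a\<in>A. measure (unif n) {p. cell_of n m p = a})"
    using A by (intro sum_mono unif_cell_ge n m) auto
  also have "\<dots> = measure (unif n) (\<Union>a\<in>A. {p. cell_of n m p = a})"
    using fin by (intro finite_measure_finite_Union[symmetric])
      (auto simp: disjoint_family_on_def cell_of_measurable)
  also have "(\<Union>a\<in>A. {p. cell_of n m p = a}) = {p. cell_of n m p \<in> A}" by auto
  finally show ?thesis .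
qed

lemma cells_of_measurable:
  assumes "A \<subseteq> cells m"
  shows "{p. cell_of n m p \<in> A} \<in> sets borel"
proof -
  have "finite A" by (rule finite_subset[OF assms finite_cells])
  moreover have "{p. cell_of n m p \<in> A} = (\<Union>a\<in>A. {p. cell_of n m p = a})" by auto
  ultimately show ?thesis using cell_of_measurable by auto
qed

section \<open>Poisson point configurations\<close>

lemma eff_res_cong:
  assumes "\<And>i j. i < N \<Longrightarrow> j < N \<Longrightarrow> adj i j = adj' i j"
  shows "eff_res N adj x y = eff_res N adj' x y"
proof -
  have "(i < N \<and> j < N \<and> adj i j) = (i < N \<and> j < N \<and> adj' i j)" for i j
    using assms by blast
  then show ?thesis unfolding eff_res_def unit_flow_def by presburger
qed

abbreviation "points n N \<equiv> PiM {..<N} (\<lambda>_. unif n)"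

lemma measurable_point: "i < N \<Longrightarrow> (\<lambda>p. p i) \<in> points n N \<rightarrow>\<^sub>M borel"
  using measurable_component_singleton[of i "{..<N}" "\<lambda>_. unif n"]
  by (simp cong: measurable_cong_sets)

text \<open>The resistances depend on \<open>p\<close> through the adjacency relation alone, which
  takes finitely many values, each of them on a measurable set.\<close>

lemma sets_eff_res_event:
  "{p \<in> space (points n N). \<forall>x<N. \<forall>y<N. eff_res N (rgg_adj r p) x y \<le> c} \<in> sets (points n N)"
proof -
  define ad where "ad p = {(i, j). i < N \<and> j < N \<and> rgg_adj r p i j}" for p
  define Q where "Q B \<longleftrightarrow> (\<forall>x<N. \<forall>y<N. eff_res N (\<lambda>i j. (i, j) \<in> B) x y \<le> c)" for B
  have Q: "(\<forall>x<N. \<forall>y<N. eff_res N (rgg_adj r p) x y \<le> c) \<longleftrightarrow> Q (ad p)" for p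
  proof -
    have "eff_res N (rgg_adj r p) x y = eff_res N (\<lambda>i j. (i, j) \<in> ad p) x y" for x y
      by (rule eff_res_cong) (simp add: ad_def)
    then show ?thesis unfolding Q_def by simp
  qed
  have ad_in: "ad p \<in> Pow ({..<N} \<times> {..<N})" for p by (auto simp: ad_def)
  have eq: "{p \<in> space (points n N). \<forall>x<N. \<forall>y<N. eff_res N (rgg_adj r p) x y \<le> c} =
     (\<Union>B\<in>{B \<in> Pow ({..<N} \<times> {..<N}). Q B}. {p \<in> space (points n N). ad p = B})"
    unfolding Q using ad_in by blast
  have "{p \<in> space (points n N). ad p = B} \<in> sets (points n N)" if B: "B \<subseteq> {..<N} \<times> {..<N}" for B
  proof -
    have s: "{p \<in> space (points n N). ad p = B} =
      {p \<in> space (points n N). \<forall>i\<in>{..<N}. \<forall>j\<in>{..<N}. (i \<noteq> j \<and> dist (p i) (p j) \<le> r) = ((i, j) \<in> B)}"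
      using B by (auto simp: ad_def rgg_adj_def set_eq_iff)
    have m: "{p \<in> space (points n N). dist (p i) (p j) \<le> r} \<in> sets (points n N)" if "i < N" "j < N" for i j
      using measurable_point[OF that(1)] measurable_point[OF that(2)] by measurable
    show ?thesis unfolding s
    proof (intro sets.sets_Collect_finite_All)
      fix i j assume ij: "i \<in> {..<N}" "j \<in> {..<N}"
      show "{p \<in> space (points n N). (i \<noteq> j \<and> dist (p i) (p j) \<le> r) = ((i, j) \<in> B)} \<in> sets (points n N)"
        using m[of i j] ij sets.sets_Collect_neg[OF m[of i j]]
        by (cases "i = j"; cases "(i, j) \<in> B") (auto simp: not_le)
    qed auto
  qed
  then show ?thesis unfolding eq by (intro sets.finite_UN) auto
qed

section \<open>Occupancy numbers and exponential moments\<close>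

definition occupancy :: "nat \<Rightarrow> int \<Rightarrow> nat \<Rightarrow> (nat \<Rightarrow> real^2) \<Rightarrow> int \<times> int \<Rightarrow> nat" where
  "occupancy n m N p a = card {i. i < N \<and> cell_of n m (p i) = a}"

lemma occupancy_eq_sum: "real (occupancy n m N p a) = (\<Sum>i<N. indicator {q. cell_of n m q = a} (p i))"
  unfolding occupancy_def by (simp add: indicator_def sum.If_cases Int_def lessThan_def)

lemma sets_sparse_event:
  fixes c :: real
  assumes "finite A"
  shows "{p \<in> space (points n N). \<forall>a\<in>A. real (occupancy n m N p a) < c} \<in> sets (points n N)"
proof (rule sets.sets_Collect_finite_All[OF _ assms])
  fix a
  have "(\<lambda>p. real (occupancy n m N p a)) \<in> borel_measurable (points n N)"
    unfolding occupancy_eq_sum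
    by (intro borel_measurable_sum measurable_compose[OF measurable_point])
      (auto intro!: borel_measurable_indicator cell_of_measurable)
  then show "{p \<in> space (points n N). real (occupancy n m N p a) < c} \<in> sets (points n N)"
    by measurable
qed

text \<open>Chernoff bound for the number of points in the cells of \<open>A\<close>; after averaging over the
  Poisson number of points this needs no independence between cells.\<close>

lemma sparse_event_prob_le:
  fixes t c :: real
  assumes n: "n > 0" and A: "A \<subseteq> cells m" and t: "t \<ge> 0"
  shows "measure (points n N) {p \<in> space (points n N). \<forall>a\<in>A. real (occupancy n m N p a) < c} \<le>
    exp (t * card A * c) * (1 - (1 - exp (- t)) * measure (unif n) {q. cell_of n m q \<in> A}) ^ N"
    (is "measure ?M ?E \<le> _")
proof -
  let ?B = "{q. cell_of n m q \<in> A}"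
  interpret U: prob_space "unif n" by (rule prob_space_unif[OF n])
  interpret P: prob_space ?M by (intro prob_space_PiM prob_space_unif n)
  interpret PU: product_prob_space "\<lambda>_ :: nat. unif n" "{..<N}" by unfold_locales
  have finA: "finite A" by (rule finite_subset[OF A finite_cells])
  \<comment> \<open>This form is linear in the indicator, which gives the expectation at once;
    \<open>f_eq\<close> is the exponential form for Markov's inequality.\<close>
  define f where "f q = 1 - (1 - exp (- t)) * indicator ?B q" for q :: "real^2"
  have f_eq: "f q = exp (- t * indicator ?B q)" for q by (simp add: f_def indicator_def)
  have int_f: "integrable (unif n) f"
    unfolding f_def using cells_of_measurable[OF A]
    by (intro Bochner_Integration.integrable_diff integrable_mult_right integrable_real_indicator) (auto simp: U.emeasure_eq_measure)
  have E_f: "integral\<^sup>L (unif n) f = 1 - (1 - exp (- t)) * measure (unif n) ?B"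
  proof -
    have "integral\<^sup>L (unif n) f = (\<integral>q. 1 \<partial>unif n) - (\<integral>q. (1 - exp (- t)) * indicator ?B q \<partial>unif n)"
      unfolding f_def using cells_of_measurable[OF A]
      by (intro Bochner_Integration.integral_diff integrable_mult_right integrable_real_indicator) (auto simp: U.emeasure_eq_measure)
    also have "(\<integral>q. (1 - exp (- t)) * indicator ?B q \<partial>unif n) = (1 - exp (- t)) * measure (unif n) ?B"
      using cells_of_measurable[OF A] by simp
    finally show ?thesis using U.prob_space by simp
  qed
  \<comment> \<open>On the event, the cells of \<open>A\<close> together hold at most
    \<open>card A * c\<close> points, so \<open>?g\<close> is at least 1 there; its integral
    factorises over the independent points.\<close>
  let ?g = "\<lambda>p. exp (t * card A * c) * (\<Prod>i<N. f (p i))"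
  have int_g: "integrable ?M ?g"
    by (intro integrable_mult_right PU.product_integrable_prod int_f) auto
  have E: "?E \<in> sets ?M" by (rule sets_sparse_event[OF finA])
  have "measure ?M ?E = (\<integral>p. indicator ?E p \<partial>?M)"
    using E by simp
  also have "\<dots> \<le> (\<integral>p. ?g p \<partial>?M)"
  proof (rule integral_mono[OF _ int_g])
    show "integrable ?M (indicator ?E :: _ \<Rightarrow> real)"
      using E by (intro integrable_real_indicator) (auto simp: P.emeasure_eq_measure)
    fix p assume "p \<in> space ?M"
    show "indicator ?E p \<le> ?g p"
    proof (cases "p \<in> ?E")
      case True
      have "(\<Sum>i<N. indicator ?B (p i)) = (\<Sum>i<N. \<Sum>a\<in>A. indicator {q. cell_of n m q = a} (p i) :: real)"
        using finA by (intro sum.cong refl) (simp add: indicator_def)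
      also have "\<dots> = (\<Sum>a\<in>A. real (occupancy n m N p a))"
        unfolding occupancy_eq_sum by (rule sum.swap)
      also have "\<dots> \<le> (\<Sum>a\<in>A. c)"
        using True by (intro sum_mono) (auto intro: less_imp_le)
      finally have le: "(\<Sum>i<N. indicator ?B (p i)) \<le> card A * c" by simp
      have "?g p = exp (t * card A * c + (\<Sum>i<N. - t * indicator ?B (p i)))"
        unfolding f_eq exp_add by (simp only: exp_sum[OF finite_lessThan])
      also have "(\<Sum>i<N. - t * indicator ?B (p i)) = - t * (\<Sum>i<N. indicator ?B (p i))"
        by (simp only: sum_distrib_left)
      finally have "?g p = exp (t * (card A * c - (\<Sum>i<N. indicator ?B (p i))))"
        by (simp add: algebra_simps)
      moreover have "0 \<le> t * (card A * c - (\<Sum>i<N. indicator ?B (p i)))"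
        using le t by (intro mult_nonneg_nonneg) auto
      ultimately show ?thesis using True by simp
    next
      case False
      have "0 \<le> f q" for q unfolding f_eq by simp
      then show ?thesis using False by (auto intro!: mult_nonneg_nonneg prod_nonneg)
    qed
  qed
  also have "\<dots> = exp (t * card A * c) * (\<Prod>i<N. integral\<^sup>L (unif n) f)"
    using PU.product_integral_prod[of "{..<N}" "\<lambda>_. f"] int_f by simp
  finally show ?thesis by (simp add: E_f)
qed

text \<open>The probability generating function of the Poisson distribution; it turns the powers
  from a fixed number of points into exponentials.\<close>

lemma poisson_pgf_sums:
  fixes x :: real
  shows
  "(\<lambda>N. real n ^ N / fact N * exp (- real n) * x ^ N) sums exp (- (real n * (1 - x)))"
proof -
  have "(\<lambda>N. exp (- real n) * ((real n * x) ^ N /\<^sub>R fact N)) sums (exp (- real n) * exp (real n * x))"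
    by (intro sums_mult exp_converges)
  moreover have "exp (- real n) * ((real n * x) ^ N /\<^sub>R fact N) = real n ^ N / fact N * exp (- real n) * x ^ N" for N
    by (simp add: power_mult_distrib divide_inverse)
  moreover have "exp (- real n) * exp (real n * x) = exp (- (real n * (1 - x)))"
    by (simp add: algebra_simps flip: exp_add)
  ultimately show ?thesis by simp
qed

text \<open>\<open>ppp_prob\<close> is an infinite sum and is informative only if it converges; the
  Poisson weights dominate it for every \<open>P\<close>.\<close>

lemma
  assumes n: "n > 0"
  shows ppp_prob_summable: "summable (\<lambda>N. (real n ^ N / fact N * exp (- real n)) *
      measure (points n N) {p \<in> space (points n N). P N p})" (is ?S)
    and ppp_prob_le_1: "ppp_prob n P \<le> 1" (is ?L)
proof -
  have w: "(\<lambda>N. real n ^ N / fact N * exp (- real n)) sums 1"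
    using poisson_pgf_sums[of n 1] by simp
  have le: "(real n ^ N / fact N * exp (- real n)) * measure (points n N) {p \<in> space (points n N). P N p}
      \<le> real n ^ N / fact N * exp (- real n)" for N
  proof -
    interpret P: prob_space "points n N" by (intro prob_space_PiM prob_space_unif n)
    show ?thesis by (intro mult_right_le_one_le P.prob_le_1) auto
  qed
  show ?S
    by (rule summable_comparison_test'[OF sums_summable[OF w], of 0]) (use le in auto)
  then show ?L
    unfolding ppp_prob_def using sums_le[OF le summable_sums w] by simp
qed

text \<open>For fixed \<open>N\<close> this is a union bound over the sets of \<open>F\<close>.
  Averaging over \<open>N\<close> turns each term into the exponential of \<open>card A\<close>
  times a rate per cell, in which \<open>n / m^2\<close> is the mean occupancy of a cell.\<close>

lemma ppp_prob_ge:
  fixes t c :: real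
  assumes n: "n > 0" and m: "m > 0" and t: "t \<ge> 0" and F: "finite F" "\<And>A. A \<in> F \<Longrightarrow> A \<subseteq> cells m"
    and meas: "\<And>N. {p \<in> space (points n N). P N p} \<in> sets (points n N)"
    and imp: "\<And>N p. (\<And>i. i < N \<Longrightarrow> p i \<in> box_n n) \<Longrightarrow> (\<And>A. A \<in> F \<Longrightarrow> \<exists>a\<in>A. c \<le> real (occupancy n m N p a)) \<Longrightarrow> P N p"
  shows "ppp_prob n P \<ge> 1 - (\<Sum>A\<in>F. exp (real (card A) * (t * c - (1 - exp (- t)) * (real n / (real_of_int m)^2))))"
proof -
  define w where "w N = real n ^ N / fact N * exp (- real n)" for N
  define b where "b A = exp (t * card A * c)" for A :: "(int \<times> int) set"
  define q where "q A = 1 - (1 - exp (- t)) * measure (unif n) {q. cell_of n m q \<in> A}" for A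
  have bound: "1 - (\<Sum>A\<in>F. b A * q A ^ N) \<le> measure (points n N) {p \<in> space (points n N). P N p}" for N
  proof -
    interpret P: prob_space "points n N" by (intro prob_space_PiM prob_space_unif n)
    let ?E = "\<lambda>A. {p \<in> space (points n N). \<forall>a\<in>A. real (occupancy n m N p a) < c}"
    have sE: "?E A \<in> P.events" if "A \<in> F" for A
      using sets_sparse_event finite_subset[OF F(2)[OF that] finite_cells] by blast
    \<comment> \<open>The underlying space is the whole plane: points lie in the box almost surely,
      and \<open>imp\<close> speaks about such configurations.\<close>
    have box: "AE q in unif n. q \<in> box_n n"
      by (rule AE_uniform_measureI) (auto simp: box_n_def)
    have "AE p in points n N. \<forall>i\<in>{..<N}. p i \<in> box_n n"
      by (intro AE_finite_allI AE_PiM_component prob_space_unif n box) auto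
    moreover have "AE p in points n N. p \<in> space (points n N)" by simp
    ultimately have "AE p in points n N. p \<in> space (points n N) - (\<Union>A\<in>F. ?E A) \<longrightarrow> p \<in> {p \<in> space (points n N). P N p}"
    proof eventually_elim
      case (elim p)
      then show ?case using imp[of N p] by (auto simp: not_less)
    qed
    then have "P.prob (space (points n N) - (\<Union>A\<in>F. ?E A)) \<le> P.prob {p \<in> space (points n N). P N p}"
      by (intro P.finite_measure_mono_AE meas)
    moreover have "P.prob (space (points n N) - (\<Union>A\<in>F. ?E A)) = 1 - P.prob (\<Union>A\<in>F. ?E A)"
      using F(1) sE by (intro P.prob_compl) auto
    moreover have "P.prob (\<Union>A\<in>F. ?E A) \<le> (\<Sum>A\<in>F. P.prob (?E A))"
      using F(1) sE by (intro P.finite_measure_subadditive_finite) auto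
    moreover have "(\<Sum>A\<in>F. P.prob (?E A)) \<le> (\<Sum>A\<in>F. b A * q A ^ N)"
      unfolding b_def q_def
    proof (rule sum_mono)
      fix A assume "A \<in> F"
      show "P.prob (?E A) \<le> exp (t * card A * c) * (1 - (1 - exp (- t)) * measure (unif n) {q. cell_of n m q \<in> A}) ^ N"
        by (rule sparse_event_prob_le[OF n F(2)[OF \<open>A \<in> F\<close>] t])
    qed
    ultimately show ?thesis by linarith
  qed
  have w1: "w sums 1" using poisson_pgf_sums[of n 1] unfolding w_def by simp
  have wq: "(\<lambda>N. w N * (b A * q A ^ N)) sums (b A * exp (- (real n * (1 - q A))))" for A
    using sums_mult[OF poisson_pgf_sums[of n "q A"], of "b A"] by (simp add: w_def mult_ac)
  have S1: "(\<lambda>N. w N - (\<Sum>A\<in>F. w N * (b A * q A ^ N))) sums (1 - (\<Sum>A\<in>F. b A * exp (- (real n * (1 - q A)))))"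
    by (intro sums_diff w1 sums_sum wq)
  have le: "w N - (\<Sum>A\<in>F. w N * (b A * q A ^ N)) \<le> w N * measure (points n N) {p \<in> space (points n N). P N p}" for N
  proof -
    have "w N - (\<Sum>A\<in>F. w N * (b A * q A ^ N)) = w N * (1 - (\<Sum>A\<in>F. b A * q A ^ N))"
      by (simp add: right_diff_distrib sum_distrib_left)
    also have "\<dots> \<le> w N * measure (points n N) {p \<in> space (points n N). P N p}"
      by (intro mult_left_mono bound) (simp add: w_def)
    finally show ?thesis .
  qed
  have S2: "(\<lambda>N. w N * measure (points n N) {p \<in> space (points n N). P N p}) sums ppp_prob n P"
    using summable_sums[OF ppp_prob_summable[OF n, of P]] by (simp add: ppp_prob_def w_def)
  have "1 - (\<Sum>A\<in>F. b A * exp (- (real n * (1 - q A)))) \<le> ppp_prob n P"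
    by (rule sums_le[OF le S1 S2])
  moreover have "(\<Sum>A\<in>F. b A * exp (- (real n * (1 - q A)))) \<le>
      (\<Sum>A\<in>F. exp (real (card A) * (t * c - (1 - exp (- t)) * (real n / (real_of_int m)^2))))"
  proof (intro sum_mono)
    fix A assume "A \<in> F"
    have "(1 - exp (- t)) * (card A / (real_of_int m)^2) \<le> 1 - q A"
      using mult_left_mono[OF unif_cells_ge[OF n m F(2)[OF \<open>A \<in> F\<close>]], of "1 - exp (- t)"] t
      by (simp add: q_def)
    then have "real n * ((1 - exp (- t)) * (card A / (real_of_int m)^2)) \<le> real n * (1 - q A)"
      by (intro mult_left_mono) auto
    moreover have "b A * exp (- (real n * (1 - q A))) = exp (t * card A * c - real n * (1 - q A))"
      unfolding b_def by (simp flip: exp_add)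
    moreover have "real (card A) * (t * c - (1 - exp (- t)) * (real n / (real_of_int m)^2)) =
        t * card A * c - real n * ((1 - exp (- t)) * (card A / (real_of_int m)^2))"
      by (simp add: algebra_simps)
    ultimately show "b A * exp (- (real n * (1 - q A))) \<le>
      exp (real (card A) * (t * c - (1 - exp (- t)) * (real n / (real_of_int m)^2)))"
      by simp
  qed
  ultimately show ?thesis by linarith
qed

section \<open>Avoiding bad windows\<close>

definition window_sets :: "int \<Rightarrow> int \<Rightarrow> (int \<times> int) set \<Rightarrow> nat \<Rightarrow> (int \<times> int) set set" where
  "window_sets m K V s = {A. \<exists>v\<in>V. A \<subseteq> window m K v \<and> card A = s}"

definition near_side :: "int \<Rightarrow> int \<Rightarrow> (int \<times> int) set" where
  "near_side m K = {v \<in> cells m. near_edge m K (fst v) \<or> near_edge m K (snd v)}"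

definition near_corner :: "int \<Rightarrow> int \<Rightarrow> (int \<times> int) set" where
  "near_corner m K = {v \<in> cells m. near_edge m K (fst v) \<and> near_edge m K (snd v)}"

text \<open>Having fewer than \<open>s\<close> bad cells in a window means that every set of
  \<open>s\<close> of its cells contains a good one. In this form the failure is a union of events
  about fixed sets of cells, as the union bound requires.\<close>

definition forbidden :: "int \<Rightarrow> int \<Rightarrow> int \<Rightarrow> (int \<times> int) set set" where
  "forbidden m R K = window_sets m K (cells m) (2 * card (half_disc R)) \<union>
     (window_sets m K (near_side m K) (card (half_disc R)) \<union> window_sets m K (near_corner m K) 1)"

lemma window_subset_cells: "window m K v \<subseteq> cells m"
  by (auto simp: window_def)

lemma forbidden_subset: "A \<in> forbidden m R K \<Longrightarrow> A \<subseteq> cells m"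
  unfolding forbidden_def window_sets_def using window_subset_cells by blast

lemma finite_window_sets: "finite (window_sets m K V s)"
proof (rule finite_subset)
  show "window_sets m K V s \<subseteq> Pow (cells m)"
    unfolding window_sets_def using window_subset_cells by blast
qed simp

lemma finite_forbidden: "finite (forbidden m R K)"
  unfolding forbidden_def by (simp add: finite_window_sets)

text \<open>Counting all subsets of a window is crude but sufficient: \<open>K\<close> will not
  depend on \<open>n\<close>, so only \<open>card V\<close> grows.\<close>

lemma card_window_sets_le:
  assumes "finite V" "K \<ge> 0"
  shows "card (window_sets m K V s) \<le> card V * 2 ^ nat ((2 * K + 1)^2)"
proof -
  have "window_sets m K V s \<subseteq> (\<Union>v\<in>V. Pow (window m K v))"
    unfolding window_sets_def by blast
  then have "card (window_sets m K V s) \<le> card (\<Union>v\<in>V. Pow (window m K v))"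
    using assms by (intro card_mono) auto
  also have "\<dots> \<le> (\<Sum>v\<in>V. card (Pow (window m K v)))"
    by (rule card_UN_le[OF assms(1)])
  also have "\<dots> \<le> (\<Sum>v\<in>V. 2 ^ nat ((2 * K + 1)^2))"
    using assms(2) by (intro sum_mono) (simp add: card_Pow card_window_le)
  finally show ?thesis by simp
qed

lemma sum_window_sets_le:
  fixes f :: "nat \<Rightarrow> real"
  assumes "finite V" "K \<ge> 0" "f s \<ge> 0" "real (card V) \<le> b"
  shows "(\<Sum>A\<in>window_sets m K V s. f (card A)) \<le> b * 2 ^ nat ((2 * K + 1)^2) * f s"
proof -
  have "(\<Sum>A\<in>window_sets m K V s. f (card A)) = (\<Sum>A\<in>window_sets m K V s. f s)"
    by (intro sum.cong) (auto simp: window_sets_def)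
  also have "\<dots> = real (card (window_sets m K V s)) * f s" by simp
  also have "\<dots> \<le> b * 2 ^ nat ((2 * K + 1)^2) * f s"
  proof (intro mult_right_mono assms(3))
    have "real (card (window_sets m K V s)) \<le> real (card V * 2 ^ nat ((2 * K + 1)^2))"
      by (intro of_nat_mono card_window_sets_le assms)
    also have "\<dots> \<le> b * 2 ^ nat ((2 * K + 1)^2)" using assms(4) by simp
    finally show "real (card (window_sets m K V s)) \<le> b * 2 ^ nat ((2 * K + 1)^2)" .
  qed
  finally show ?thesis .
qed

lemma
  assumes K: "K \<ge> 0" and m: "m \<ge> 0"
  shows card_near_side_le: "real (card (near_side m K)) \<le> 4 * real_of_int K * real_of_int m"
    and card_near_corner_le: "real (card (near_corner m K)) \<le> 4 * (real_of_int K)^2"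
proof -
  define E where "E = {0..<K} \<union> {m - K..<m}"
  have "card E \<le> card {0..<K} + card {m - K..<m}" unfolding E_def by (rule card_Un_le)
  then have E: "real (card E) \<le> 2 * real_of_int K" using K by simp
  have fE: "finite E" by (simp add: E_def)
  have "near_side m K \<subseteq> E \<times> {0..<m} \<union> {0..<m} \<times> E"
    by (auto simp: near_side_def near_edge_def E_def mem_cells mem_Times_iff)
  then have "card (near_side m K) \<le> card (E \<times> {0..<m} \<union> {0..<m} \<times> E)"
    using fE by (intro card_mono) auto
  also have "\<dots> \<le> card (E \<times> {0..<m}) + card ({0..<m} \<times> E)" by (rule card_Un_le)
  finally have "real (card (near_side m K)) \<le> real (card (E \<times> {0..<m}) + card ({0..<m} \<times> E))" by (rule of_nat_mono)
  also have "\<dots> = 2 * (real (card E) * real_of_int m)" using m by (simp add: card_cartesian_product)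
  also have "\<dots> \<le> 2 * (2 * real_of_int K * real_of_int m)"
    using m by (intro mult_left_mono mult_right_mono E) auto
  finally show "real (card (near_side m K)) \<le> 4 * real_of_int K * real_of_int m" by simp
  have "near_corner m K \<subseteq> E \<times> E"
    by (auto simp: near_corner_def near_edge_def E_def mem_cells mem_Times_iff)
  then have "card (near_corner m K) \<le> card (E \<times> E)"
    using fE by (intro card_mono) auto
  then have "real (card (near_corner m K)) \<le> real (card E) * real (card E)"
    by (metis card_cartesian_product of_nat_le_iff of_nat_mult)
  also have "\<dots> \<le> (2 * real_of_int K) * (2 * real_of_int K)" by (intro mult_mono E) (use K in auto)
  finally show "real (card (near_corner m K)) \<le> 4 * (real_of_int K)^2" by (simp add: power2_eq_square)
qed

lemma sum_forbidden_le:
  fixes f :: "nat \<Rightarrow> real"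
  assumes K: "K \<ge> 0" and m: "m \<ge> 0" and f: "\<And>s. f s \<ge> 0"
  shows "(\<Sum>A\<in>forbidden m R K. f (card A)) \<le> 2 ^ nat ((2 * K + 1)^2) *
    ((real_of_int m)^2 * f (2 * card (half_disc R)) + 4 * real_of_int K * real_of_int m * f (card (half_disc R)) +
     4 * (real_of_int K)^2 * f 1)"
proof -
  have un: "sum g (A \<union> B) \<le> sum g A + sum g B" if "finite A" "finite B" "\<And>x. g x \<ge> 0"
    for g :: "(int \<times> int) set \<Rightarrow> real" and A B
    using sum.union_inter[OF that(1,2), of g] sum_nonneg[of "A \<inter> B" g] that(3) by fastforce
  let ?g = "\<lambda>A :: (int \<times> int) set. f (card A)" and ?w = "2 ^ nat ((2 * K + 1)^2) :: real"
  have c: "real (card (cells m)) \<le> (real_of_int m)^2"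
    using m by (simp add: cells_def card_cartesian_product power2_eq_square)
  have fin: "finite (near_side m K)" "finite (near_corner m K)"
    by (auto simp: near_side_def near_corner_def)
  have "sum ?g (forbidden m R K) \<le> sum ?g (window_sets m K (cells m) (2 * card (half_disc R))) +
     (sum ?g (window_sets m K (near_side m K) (card (half_disc R))) + sum ?g (window_sets m K (near_corner m K) 1))"
    unfolding forbidden_def
    by (intro order_trans[OF un] add_left_mono un finite_UnI finite_window_sets f)
  also have "\<dots> \<le> (real_of_int m)^2 * ?w * f (2 * card (half_disc R)) +
      (4 * real_of_int K * real_of_int m * ?w * f (card (half_disc R)) + 4 * (real_of_int K)^2 * ?w * f 1)"
    by (intro add_mono sum_window_sets_le f K c fin finite_cells card_near_side_le card_near_corner_le m)
  finally show ?thesis by (simp add: algebra_simps)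
qed

lemma sparse_bad_cells_if_forbidden_met:
  assumes "R \<ge> 3" "K \<ge> 2 * int (card (half_disc R)) + 2 * R + 1" "m \<ge> 2 * K + 2"
    and met: "\<And>A. A \<in> forbidden m R K \<Longrightarrow> \<exists>a\<in>A. g a"
  shows "sparse_bad_cells m R K g"
proof -
  have few: "card {w \<in> window m K v. \<not> g w} < s"
    if "v \<in> V" "window_sets m K V s \<subseteq> forbidden m R K" for v V s
  proof (rule ccontr)
    assume "\<not> ?thesis"
    then have "s \<le> card {w \<in> window m K v. \<not> g w}" by simp
    then obtain A where A: "A \<subseteq> {w \<in> window m K v. \<not> g w}" "card A = s"
      by (rule obtain_subset_with_card_n)
    then have "A \<in> window_sets m K V s" using that(1) unfolding window_sets_def by blast
    with that(2) met A(1) show False by blast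
  qed
  show ?thesis
  proof (unfold_locales, goal_cases)
    case (4 v)
    then show ?case by (rule few) (auto simp: forbidden_def)
  next
    case (5 v)
    then have "v \<in> near_side m K" by (simp add: near_side_def)
    then show ?case by (rule few) (auto simp: forbidden_def)
  next
    case (6 v w)
    then have "v \<in> near_corner m K" by (simp add: near_corner_def)
    then have "card {w \<in> window m K v. \<not> g w} < 1" by (rule few) (auto simp: forbidden_def)
    then have "{w \<in> window m K v. \<not> g w} = {}" by simp
    then show ?case using 6(4) by blast
  qed (use assms in auto)
qed

text \<open>Here \<open>\<epsilon>\<close> is spent. Two half discs have asymptotically
  \<open>pi * R^2\<close> cells as \<open>R\<close> grows. The inequality says that
  \<open>2h\<close> cells of side \<open>r / R\<close> have total area larger than
  \<open>log n\<close>.\<close>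

lemma ex_radius:
  assumes "\<epsilon> > 0"
  shows "\<exists>R :: int. R \<ge> 3 \<and> pi * (real_of_int R)^2 < (1 + \<epsilon>) * (2 * real (card (half_disc R)))"
proof -
  have "eventually (\<lambda>x :: real. pi * x^2 < (1 + \<epsilon>) * (pi * (x - 3)^2 - 2 * x - 1)) at_top"
    using assms by real_asymp
  then have "eventually (\<lambda>n :: nat. pi * (real n)^2 < (1 + \<epsilon>) * (pi * (real n - 3)^2 - 2 * real n - 1)) sequentially"
    by (rule eventually_compose_filterlim[OF _ filterlim_real_sequentially])
  then have "eventually (\<lambda>n :: nat. pi * (real n)^2 < (1 + \<epsilon>) * (pi * (real n - 3)^2 - 2 * real n - 1) \<and> n \<ge> 3) sequentially"
    using eventually_ge_at_top[of 3] by eventually_elim auto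
  then obtain n :: nat where n: "pi * (real n)^2 < (1 + \<epsilon>) * (pi * (real n - 3)^2 - 2 * real n - 1)" "n \<ge> 3"
    using eventually_happens'[OF sequentially_bot] by blast
  have "pi * (real_of_int (int n) - 3)^2 - 2 * real_of_int (int n) - 1 \<le> 2 * real (card (half_disc (int n)))"
    using n(2) by (intro card_half_disc_ge) auto
  then have "(1 + \<epsilon>) * (pi * (real n - 3)^2 - 2 * real n - 1) \<le> (1 + \<epsilon>) * (2 * real (card (half_disc (int n))))"
    using assms by (intro mult_left_mono) auto
  then show ?thesis using n by (intro exI[of _ "int n"]) auto
qed

section \<open>Asymptotics of the mesh, and the final choice of constants\<close>

lemma exp_neg_ln_tendsto: "\<gamma> < 0 \<Longrightarrow> (\<lambda>n. exp (\<gamma> * ln (real n))) \<longlonglongrightarrow> 0"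
  by real_asymp

text \<open>With \<open>r = sqrt (q * ln n)\<close>, \<open>m\<close> is
  \<open>R * sqrt n / r\<close> rounded up, which makes the cell side at most \<open>r / R\<close>.
  Rounding costs a vanishing proportion, so every density \<open>b\<close> below
  \<open>q / R^2\<close> is eventually attained.\<close>

lemma mesh_asymptotics:
  fixes q R b c :: real
  assumes "q > 0" "R > 0" "0 < b" "b < q / R^2"
  defines "m \<equiv> \<lambda>n :: nat. \<lceil>R * sqrt (real n) / sqrt (q * ln (real n))\<rceil>"
  shows "eventually (\<lambda>n. n \<ge> 3 \<and> real_of_int (m n) \<ge> c \<and> m n > 0 \<and> real_of_int (m n) \<le> sqrt (real n) \<and>
    b * ln (real n) \<le> real n / (real_of_int (m n))^2) sequentially"
proof -
  let ?y = "\<lambda>n :: nat. R * sqrt (real n) / sqrt (q * ln (real n))"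
  \<comment> \<open>\<open>\<kappa>\<close> is the share of \<open>sqrt n\<close> used before
    rounding; the remaining share \<open>\<eta>\<close> pays for the 1 lost in the ceiling.\<close>
  define \<kappa> where "\<kappa> = R * sqrt (b / q)"
  have "b * R^2 / q < 1" using assms(1-4) by (simp add: field_simps)
  then have "sqrt (b * R^2 / q) < 1" by simp
  then have \<kappa>: "\<kappa> < 1" using assms(2) by (simp add: \<kappa>_def real_sqrt_mult real_sqrt_divide mult_ac)
  define \<eta> where "\<eta> = 1 - \<kappa>"
  have \<eta>: "\<eta> > 0" using \<kappa> by (simp add: \<eta>_def)
  have "eventually (\<lambda>n. ?y n \<ge> c) sequentially" using assms(1,2) by real_asymp
  moreover have "eventually (\<lambda>n. ?y n + 1 \<le> sqrt (real n)) sequentially" using assms(1,2) by real_asymp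
  moreover have "eventually (\<lambda>n. sqrt (b * ln (real n)) \<le> \<eta> * sqrt (real n)) sequentially"
    using assms(3) \<eta> by real_asymp
  ultimately show ?thesis using eventually_ge_at_top[of 3]
  proof eventually_elim
    case (elim n)
    have ln: "ln (real n) > 0" using elim by simp
    have y: "?y n > 0" using elim assms(1,2) ln by simp
    have m: "?y n \<le> of_int (m n)" "of_int (m n) \<le> ?y n + 1" unfolding m_def by linarith+
    have m0: "real_of_int (m n) > 0" using m y by linarith
    have "sqrt (b * ln (real n)) * (?y n + 1) = \<kappa> * sqrt (real n) + sqrt (b * ln (real n))"
      using assms ln by (simp add: \<kappa>_def real_sqrt_mult real_sqrt_divide field_simps)
    also have "\<dots> \<le> \<kappa> * sqrt (real n) + \<eta> * sqrt (real n)" using elim by simp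
    also have "\<dots> = sqrt (real n)" by (simp add: \<eta>_def algebra_simps)
    finally have "sqrt (b * ln (real n)) * real_of_int (m n) \<le> sqrt (real n)"
      using assms ln by (intro order_trans[OF mult_left_mono[OF m(2)]]) auto
    then have "(sqrt (b * ln (real n)) * real_of_int (m n))^2 \<le> (sqrt (real n))^2"
      using assms ln m0 by (intro power_mono) auto
    then have "b * ln (real n) * (real_of_int (m n))^2 \<le> real n"
      using assms ln by (simp add: power_mult_distrib)
    then have "b * ln (real n) \<le> real n / (real_of_int (m n))^2"
      using m0 by (simp add: pos_le_divide_eq)
    then show ?case using elim m m0 by auto
  qed
qed

lemma eff_res_bound_if_forbidden_met:
  assumes n: "n > 0" and R: "R \<ge> 3" and K: "K \<ge> 2 * int (card (half_disc R)) + 2 * R + 1" and m: "m \<ge> 2 * K + 2"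
    and c: "c > 0" and r: "real_of_int R * (sqrt (real n) / of_int m) \<le> r"
    and p: "\<And>i. i < N \<Longrightarrow> p i \<in> box_n n"
    and met: "\<And>A. A \<in> forbidden m R K \<Longrightarrow> \<exists>a\<in>A. c \<le> real (occupancy n m N p a)"
    and xy: "x < N" "y < N"
  shows "eff_res N (rgg_adj r p) x y \<le> ennreal (6 / c + (2 * real_of_int K + 3)^16 / c^2 * (264 * (1 + ln (real_of_int m))))"
proof -
  \<comment> \<open>Occupancy numbers are integers, so rounding \<open>c\<close> up loses
    nothing.\<close>
  define k where "k = nat \<lceil>c\<rceil>"
  have k: "k \<ge> 1" "c \<le> real k" using c unfolding k_def by linarith+
  have m0: "m > 0" using m K R by linarith
  have "cell_config m R K N (rgg_adj r p) (\<lambda>i. cell_of n m (p i)) k"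
  proof (rule cell_config.intro)
    show "sparse_bad_cells m R K (\<lambda>a. k \<le> card {i. i < N \<and> cell_of n m (p i) = a})"
    proof (rule sparse_bad_cells_if_forbidden_met[OF R K m])
      fix A assume "A \<in> forbidden m R K"
      from met[OF this] show "\<exists>a\<in>A. k \<le> card {i. i < N \<and> cell_of n m (p i) = a}"
        unfolding occupancy_def k_def by (auto simp: nat_le_iff ceiling_le_iff)
    qed
    show "1 \<le> k" by (rule k)
    show "cell_of n m (p i) \<in> cells m" if "i < N" for i
      by (rule cell_of_mem[OF n m0 p[OF that]])
    show "rgg_adj r p i j" if "i < N" "j < N" "i \<noteq> j" "cell_near R (cell_of n m (p i)) (cell_of n m (p j))" for i j
      unfolding rgg_adj_def
      using that(3) dist_le_of_cell_near[OF n m0 _ p[OF that(1)] p[OF that(2)] that(4) r] R by auto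
  qed
  from cell_config.effective_resistance_bound[OF this xy]
  obtain \<theta> where \<theta>: "unit_flow N (rgg_adj r p) x y \<theta>"
    "flow_energy N \<theta> \<le> 6 / k + (2 * real_of_int K + 3)^16 / k^2 * (264 * (1 + ln (real_of_int m)))" by blast
  have "eff_res N (rgg_adj r p) x y \<le> ennreal (flow_energy N \<theta>)"
    unfolding eff_res_def using \<theta>(1) by (intro INF_lower) simp
  also have "\<dots> \<le> ennreal (6 / c + (2 * real_of_int K + 3)^16 / c^2 * (264 * (1 + ln (real_of_int m))))"
  proof (rule ennreal_leI)
    have "0 \<le> ln (real_of_int m)" using m0 by simp
    then have "6 / k + (2 * real_of_int K + 3)^16 / k^2 * (264 * (1 + ln (real_of_int m))) \<le>
      6 / c + (2 * real_of_int K + 3)^16 / c^2 * (264 * (1 + ln (real_of_int m)))"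
      using k c K R by (intro add_mono mult_right_mono divide_left_mono) (auto intro!: power_mono mult_pos_pos)
    with \<theta>(2) show "flow_energy N \<theta> \<le> \<dots>" by (rule order_trans)
  qed
  finally show ?thesis .
qed

theorem mainTheorem15:
  fixes \<epsilon> :: real
  assumes "\<epsilon> > 0"
  shows "\<exists>C>0. (\<lambda>n. ppp_prob n (\<lambda>N p. \<forall>x<N. \<forall>y<N.
            eff_res N (rgg_adj (sqrt ((1 + \<epsilon>) * ln (real n) / pi)) p) x y
              \<le> ennreal (C / ln (real n)))) \<longlonglongrightarrow> 1"
proof -
  obtain R :: int where R: "R \<ge> 3" and R_gap: "pi * (real_of_int R)^2 < (1 + \<epsilon>) * (2 * real (card (half_disc R)))"
    using ex_radius[OF assms] by blast
  define h where "h = card (half_disc R)"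
  define K where "K = 2 * int h + 2 * R + 1"
  define q where "q = (1 + \<epsilon>) / pi"
  have K0: "K \<ge> 0" using R by (simp add: K_def)
  have q: "q > 0" using assms by (simp add: q_def)
  have R2: "(real_of_int R)^2 > 0" using R by simp
  have h: "real h > 0"
  proof (rule ccontr)
    assume "\<not> real h > 0"
    then have "pi * (real_of_int R)^2 < 0" using R_gap by (simp add: h_def)
    then show False using R2 by (simp add: mult_less_0_iff)
  qed
  have gap: "1 / (2 * real h) < q / (real_of_int R)^2"
    using R_gap h R2 by (simp add: q_def h_def field_simps)
  \<comment> \<open>The gap is used twice: \<open>\<beta>1 * ln n\<close> will bound the mean
    occupancy of a cell from below, and \<open>\<beta> * ln n\<close> is the exponent that each cell
    contributes after the Chernoff bound.\<close>
  define \<beta>1 where "\<beta>1 = (1 / (2 * real h) + q / (real_of_int R)^2) / 2"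
  define \<beta> where "\<beta> = (1 / (2 * real h) + \<beta>1) / 2"
  have \<beta>1: "1 / (2 * real h) < \<beta>1" "\<beta>1 < q / (real_of_int R)^2" using gap by (auto simp: \<beta>1_def)
  have \<beta>: "1 / (2 * real h) < \<beta>" "\<beta> < \<beta>1" using \<beta>1 by (auto simp: \<beta>_def)
  have inv_h: "1 / (2 * real h) > 0" using h by simp
  have \<beta>_pos: "\<beta> > 0" "\<beta>1 > 0" using \<beta> inv_h by linarith+
  \<comment> \<open>The difference of \<open>\<beta>1\<close> and \<open>\<beta>\<close> is split
    evenly: \<open>t\<close> is chosen so that \<open>exp (- t) * \<beta>1\<close> is one half of
    it, and \<open>\<delta>\<close> so that \<open>t * \<delta>\<close> is the other half.\<close>
  define t where "t = - ln ((\<beta>1 - \<beta>) / (2 * \<beta>1))"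
  define \<delta> where "\<delta> = (\<beta>1 - \<beta>) / (2 * t)"
  have frac: "0 < (\<beta>1 - \<beta>) / (2 * \<beta>1)" "(\<beta>1 - \<beta>) / (2 * \<beta>1) < 1"
    using \<beta> \<beta>_pos by (auto simp: field_simps)
  have t: "t > 0" using frac unfolding t_def by simp
  have \<delta>: "\<delta> > 0" using t \<beta> by (simp add: \<delta>_def)
  have exp_t: "exp (- t) = (\<beta>1 - \<beta>) / (2 * \<beta>1)" using frac by (simp add: t_def)
  have rate: "t * \<delta> - (1 - exp (- t)) * \<beta>1 = - \<beta>"
    unfolding exp_t using t \<beta>_pos by (simp add: \<delta>_def field_simps)
  define r where "r n = sqrt ((1 + \<epsilon>) * ln (real n) / pi)" for n :: nat
  define m where "m n = \<lceil>real_of_int R * sqrt (real n) / sqrt (q * ln (real n))\<rceil>" for n :: nat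
  have r_eq: "r n = sqrt (q * ln (real n))" for n by (simp add: r_def q_def)
  define C0 where "C0 = (2 * real_of_int K + 3)^16"
  \<comment> \<open>Here \<open>528 = 2 * 264\<close>, because \<open>1 + ln m\<close> is at most
    \<open>2 * ln n\<close> for large \<open>n\<close>.\<close>
  define C where "C = 6 / \<delta> + 528 * C0 / \<delta>^2"
  have C0: "C0 \<ge> 0" using K0 by (simp add: C0_def)
  have C: "C > 0" using \<delta> C0 unfolding C_def by (intro add_pos_nonneg) auto
  define P where "P n = (\<lambda>N p. \<forall>x<N. \<forall>y<N. eff_res N (rgg_adj (r n) p) x y \<le> ennreal (C / ln (real n)))" for n
  \<comment> \<open>The terms belong to bulk, sides and corners: numbers of windows of order at most
    \<open>n\<close>, \<open>\<surd>n\<close> and 1 are merged with the decay for sets of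
    \<open>2h\<close>, \<open>h\<close> and 1 bad cells.\<close>
  define err where "err n = 2 ^ nat ((2 * K + 1)^2) * (exp ((1 - 2 * real h * \<beta>) * ln (real n)) +
      4 * real_of_int K * exp ((1 / 2 - real h * \<beta>) * ln (real n)) + 4 * (real_of_int K)^2 * exp (- \<beta> * ln (real n)))" for n :: nat
  have ev: "eventually (\<lambda>n. n \<ge> 3 \<and> real_of_int (m n) \<ge> real_of_int (2 * K + 2) \<and> m n > 0 \<and>
      real_of_int (m n) \<le> sqrt (real n) \<and> \<beta>1 * ln (real n) \<le> real n / (real_of_int (m n))^2) sequentially"
    unfolding m_def by (rule mesh_asymptotics) (use q R \<beta>_pos \<beta>1 in auto)
  have lower: "eventually (\<lambda>n. 1 - err n \<le> ppp_prob n (P n)) sequentially"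
    using ev
  proof eventually_elim
    case (elim n)
    define L where "L = ln (real n)"
    have "exp 1 \<le> (3 :: real)" by (rule exp_le)
    also have "(3 :: real) \<le> real n" using elim by simp
    finally have L: "L \<ge> 1" unfolding L_def using elim by (subst ln_ge_iff) auto
    have n: "n > 0" and m: "m n > 0" "m n \<ge> 2 * K + 2" using elim by linarith+
    have sqrt_n: "sqrt (real n) = exp (1 / 2 * L)"
      using n by (simp add: L_def powr_half_sqrt[symmetric] powr_def)
    have n_exp: "real n = exp L" using n by (simp add: L_def)
    have m_n: "(real_of_int (m n))^2 \<le> real n"
      using power_mono[of "real_of_int (m n)" "sqrt (real n)" 2] elim by simp
    have m_exp: "(real_of_int (m n))^2 \<le> exp L" "real_of_int (m n) \<le> exp (1 / 2 * L)"
      using m_n elim sqrt_n n_exp by simp_all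
    define f where "f s = exp (real s * (t * (\<delta> * L) - (1 - exp (- t)) * (real n / (real_of_int (m n))^2)))" for s :: nat
    have f_le: "f s \<le> exp (- (\<beta> * real s * L))" for s
    proof -
      have "(1 - exp (- t)) * (\<beta>1 * L) \<le> (1 - exp (- t)) * (real n / (real_of_int (m n))^2)"
        using elim t by (intro mult_left_mono) (auto simp: L_def)
      then have "t * (\<delta> * L) - (1 - exp (- t)) * (real n / (real_of_int (m n))^2) \<le>
          (t * \<delta> - (1 - exp (- t)) * \<beta>1) * L"
        by (simp add: algebra_simps)
      then have "real s * (t * (\<delta> * L) - (1 - exp (- t)) * (real n / (real_of_int (m n))^2)) \<le> real s * (- \<beta> * L)"
        unfolding rate by (intro mult_left_mono) auto
      then show ?thesis unfolding f_def by (simp add: mult_ac)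
    qed
    have "(\<Sum>A\<in>forbidden (m n) R K. f (card A)) \<le> 2 ^ nat ((2 * K + 1)^2) *
      ((real_of_int (m n))^2 * f (2 * h) + 4 * real_of_int K * real_of_int (m n) * f h + 4 * (real_of_int K)^2 * f 1)"
      unfolding h_def using m by (intro sum_forbidden_le K0) (auto simp: f_def)
    also have "\<dots> \<le> 2 ^ nat ((2 * K + 1)^2) * (exp L * exp (- (\<beta> * real (2 * h) * L)) +
        4 * real_of_int K * exp (1 / 2 * L) * exp (- (\<beta> * real h * L)) + 4 * (real_of_int K)^2 * exp (- (\<beta> * real 1 * L)))"
      using m_exp K0 m
      by (intro mult_left_mono add_mono mult_mono f_le) (auto simp: f_def)
    also have "\<dots> = err n"
      unfolding err_def L_def[symmetric] mult.assoc exp_add[symmetric] by (simp add: algebra_simps)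
    finally have err: "(\<Sum>A\<in>forbidden (m n) R K. f (card A)) \<le> err n" .
    have "1 - (\<Sum>A\<in>forbidden (m n) R K. f (card A)) \<le> ppp_prob n (P n)"
      unfolding f_def
    proof (rule ppp_prob_ge[OF n m(1) less_imp_le[OF t] finite_forbidden forbidden_subset])
      show "{p \<in> space (points n N). P n N p} \<in> sets (points n N)" for N
        unfolding P_def by (rule sets_eff_res_event)
      fix N and p :: "nat \<Rightarrow> real^2"
      assume p: "\<And>i. i < N \<Longrightarrow> p i \<in> box_n n"
        and met: "\<And>A. A \<in> forbidden (m n) R K \<Longrightarrow> \<exists>a\<in>A. \<delta> * L \<le> real (occupancy n (m n) N p a)"
      show "P n N p"
        unfolding P_def
      proof (intro allI impI)
        fix x y assume xy: "x < N" "y < N"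
        have r0: "r n > 0" using q L by (simp add: r_eq L_def[symmetric])
        have "real_of_int R * sqrt (real n) / r n \<le> of_int (m n)"
          unfolding m_def r_eq by linarith
        then have r: "real_of_int R * (sqrt (real n) / of_int (m n)) \<le> r n"
          using r0 m by (simp add: field_simps)
        have "eff_res N (rgg_adj (r n) p) x y \<le>
            ennreal (6 / (\<delta> * L) + (2 * real_of_int K + 3)^16 / (\<delta> * L)^2 * (264 * (1 + ln (real_of_int (m n)))))"
          using K_def h_def \<delta> L
          by (intro eff_res_bound_if_forbidden_met[OF n R _ m(2) _ r p met xy]) auto
        also have "\<dots> \<le> ennreal (C / L)"
        proof (rule ennreal_leI)
          have "real_of_int (m n) \<le> (real_of_int (m n))^2"
            using m by (simp add: power2_eq_square)
          then have "real_of_int (m n) \<le> real n" using m_n by (rule order_trans)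
          then have "ln (real_of_int (m n)) \<le> L"
            unfolding L_def using m(1) n by (intro ln_mono) auto
          then have "1 + ln (real_of_int (m n)) \<le> 2 * L" using L by linarith
          then have "C0 / (\<delta> * L)^2 * (264 * (1 + ln (real_of_int (m n)))) \<le> C0 / (\<delta> * L)^2 * (264 * (2 * L))"
            using C0 by (intro mult_left_mono) auto
          also have "\<dots> = 528 * C0 / \<delta>^2 / L"
            using L \<delta> by (simp add: field_simps power2_eq_square)
          finally show "6 / (\<delta> * L) + (2 * real_of_int K + 3)^16 / (\<delta> * L)^2 * (264 * (1 + ln (real_of_int (m n)))) \<le> C / L"
            unfolding C_def C0_def[symmetric] by (simp add: add_divide_distrib)
        qed
        finally show "eff_res N (rgg_adj (r n) p) x y \<le> ennreal (C / ln (real n))" unfolding L_def .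
      qed
    qed
    with err show ?case by linarith
  qed
  have upper: "eventually (\<lambda>n. ppp_prob n (P n) \<le> 1) sequentially"
    using eventually_gt_at_top[of 0] by eventually_elim (rule ppp_prob_le_1)
  \<comment> \<open>The inequality \<open>2 * h * \<beta> > 1\<close> settles bulk and sides at
    once; for the corners \<open>\<beta> > 0\<close> is enough.\<close>
  have "1 - 2 * real h * \<beta> < 0" "1 / 2 - real h * \<beta> < 0" "- \<beta> < 0"
    using \<beta>(1) h \<beta>_pos by (auto simp: field_simps)
  note lim = this[THEN exp_neg_ln_tendsto]
  have "err \<longlonglongrightarrow> 2 ^ nat ((2 * K + 1)^2) * (0 + 4 * real_of_int K * 0 + 4 * (real_of_int K)^2 * 0)"
    unfolding err_def by (intro tendsto_mult tendsto_add tendsto_const lim)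
  then have "(\<lambda>n. 1 - err n) \<longlonglongrightarrow> 1 - 0"
    by (intro tendsto_diff tendsto_const) simp
  then have "(\<lambda>n. 1 - err n) \<longlonglongrightarrow> 1" by simp
  then have "(\<lambda>n. ppp_prob n (P n)) \<longlonglongrightarrow> 1"
    by (rule tendsto_sandwich[OF lower upper _ tendsto_const])
  then show ?thesis
    unfolding P_def r_def using C by blast
qed

end
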